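(* Let $R=\mathbb{C}[x,y,z]$ and $J=(yz(y-z),\,zx(z-x),\,xy(x-y))\subseteq R$. Then $\rho(J)=\widehat{\rho}(J)=\frac{6}{5}$.
   Context: $I^{(m)}=\bigcap_{\mathfrak p\in \operatorname{Ass}(R/I)} (I^mR_{\mathfrak p}\cap R)$ is the $m$-th symbolic power. The resurgence is $\rho(I)=\sup\{m/r : I^{(m)}\not\subseteq I^r\}$ and the asymptotic resurgence is $\widehat{\rho}(I)=\sup\{m/r : I^{(mt)}\not\subseteq I^{rt}\text{ for all } t\gg 0\}$. *)

theory Defs
  imports Complex_Main "HOL-Computational_Algebra.Polynomial" "HOL-Library.Extended_Real"
begin

definition is_ideal :: "'a::comm_ring_1 set \<Rightarrow> bool" where
  "is_ideal I \<longleftrightarrow> 0 \<in> I \<and> (\<forall>a\<in>I. \<forall>b\<in>I. a + b \<in> I) \<and> (\<forall>a\<in>I. \<forall>r. r * a \<in> I)"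

definition gen_ideal :: "'a::comm_ring_1 set \<Rightarrow> 'a set" where
  "gen_ideal S = \<Inter>{I. is_ideal I \<and> S \<subseteq> I}"

fun ideal_pow :: "'a::comm_ring_1 set \<Rightarrow> nat \<Rightarrow> 'a set" where
  "ideal_pow I 0 = UNIV"
| "ideal_pow I (Suc n) = gen_ideal {a * b | a b. a \<in> I \<and> b \<in> ideal_pow I n}"

definition prime_ideal :: "'a::comm_ring_1 set \<Rightarrow> bool" where
  "prime_ideal P \<longleftrightarrow> is_ideal P \<and> P \<noteq> UNIV \<and> (\<forall>a b. a * b \<in> P \<longrightarrow> a \<in> P \<or> b \<in> P)"

definition Ass :: "'a::comm_ring_1 set \<Rightarrow> 'a set set" where
  "Ass I = {P. prime_ideal P \<and> (\<exists>a. P = {r. r * a \<in> I})}"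

text \<open>Symbolic power: \<open>I^(m) = \<Inter>_{P \<in> Ass(R/I)} (I^m R_P \<inter> R)\<close>, where
  \<open>I^m R_P \<inter> R = {f. \<exists>s \<notin> P. s f \<in> I^m}\<close> (R a domain).\<close>

definition symbolic_power :: "'a::idom set \<Rightarrow> nat \<Rightarrow> 'a set" where
  "symbolic_power I m = {f. \<forall>P\<in>Ass I. \<exists>s. s \<notin> P \<and> s * f \<in> ideal_pow I m}"

definition resurgence :: "'a::idom set \<Rightarrow> ereal" where
  "resurgence I = Sup {ereal (real m / real r) | m r. m \<ge> 1 \<and> r \<ge> 1 \<and>
       \<not> symbolic_power I m \<subseteq> ideal_pow I r}"

definition asymptotic_resurgence :: "'a::idom set \<Rightarrow> ereal" where
  "asymptotic_resurgence I = Sup {ereal (real m / real r) | m r. m \<ge> 1 \<and> r \<ge> 1 \<and>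
       (\<forall>\<^sub>F t in sequentially. \<not> symbolic_power I (m * t) \<subseteq> ideal_pow I (r * t))}"

type_synonym cpoly3 = "complex poly poly poly"

definition varX :: cpoly3 where "varX = [:[:[:0, 1:]:]:]"
definition varY :: cpoly3 where "varY = [:[:0, 1:]:]"
definition varZ :: cpoly3 where "varZ = [:0, 1:]"

end

theory Submission
  imports Defs "HOL-Real_Asymp.Real_Asymp"
begin

text \<open>
  \<open>J\<close> is the radical ideal of the seven points [100], [010], [001], [111], [110], [101], [011], and
  \<open>J = (F, X K)\<close>, where \<open>F = Y Z (Y - Z)\<close> and \<open>K = (Z (Z - X), Y (Y - X))\<close> is the complete
  intersection of the four points off the line \<open>X = 0\<close>.

  Upper bound: a polynomial vanishing to order \<open>r\<close> at the seven points lies in \<open>K\<^sup>r\<close>; if its order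
  at the origin is at least \<open>3 r + 1\<close>, then repeatedly restricting to \<open>X = 0\<close> and splitting off
  \<open>F\<^sup>j K\<^sup>r\<^sup>-\<^sup>j\<close> shows that it lies in \<open>J\<^sup>r\<close>. A quadratic Cremona transformation contracting three lines to
  [110], [101], [011] shows that vanishing to order \<open>m\<close> at the seven points forces order at least
  \<open>5 m / 2\<close> at the origin. Hence \<open>5 m > 6 r\<close> implies that the \<open>m\<close>-th symbolic power is contained
  in \<open>J\<^sup>r\<close>.

  Lower bound: a product of lines of degree 15 lies in the sixth symbolic power, while \<open>J\<^sup>r\<close>
  starts in degree \<open>3 r\<close>.
\<close>

subsection \<open>Ideals and their powers\<close>

lemma is_ideal_gen_ideal: "is_ideal (gen_ideal S)"
  unfolding gen_ideal_def is_ideal_def by blast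

lemma gen_ideal_base: "a \<in> S \<Longrightarrow> a \<in> gen_ideal S"
  unfolding gen_ideal_def by blast

lemma gen_ideal_least: "is_ideal I \<Longrightarrow> S \<subseteq> I \<Longrightarrow> gen_ideal S \<subseteq> I"
  unfolding gen_ideal_def by blast

lemma
  assumes "is_ideal I"
  shows ideal_zero: "0 \<in> I"
    and ideal_add: "a \<in> I \<Longrightarrow> b \<in> I \<Longrightarrow> a + b \<in> I"
    and ideal_multL: "a \<in> I \<Longrightarrow> r * a \<in> I"
    and ideal_multR: "a \<in> I \<Longrightarrow> a * r \<in> I"
    and ideal_uminus: "a \<in> I \<Longrightarrow> - a \<in> I"
    and ideal_diff: "a \<in> I \<Longrightarrow> b \<in> I \<Longrightarrow> a - b \<in> I"
proof -
  show mult: "r * a \<in> I" if "a \<in> I" for a r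
    using assms that by (simp add: is_ideal_def)
  show add: "a + b \<in> I" if "a \<in> I" "b \<in> I" for a b
    using assms that by (simp add: is_ideal_def)
  show "0 \<in> I" using assms by (simp add: is_ideal_def)
  show "a * r \<in> I" if "a \<in> I" using mult[OF that, of r] by (simp add: mult.commute)
  show uminus: "- a \<in> I" if "a \<in> I" for a using mult[OF that, of "- 1"] by simp
  show "a - b \<in> I" if "a \<in> I" "b \<in> I" using add[OF that(1) uminus[OF that(2)]] by simp
qed

lemma ideal_sum: "is_ideal I \<Longrightarrow> (\<And>i. i \<in> A \<Longrightarrow> f i \<in> I) \<Longrightarrow> sum f A \<in> I"
  by (induction A rule: infinite_finite_induct) (auto intro: ideal_add ideal_zero)

lemma is_ideal_UNIV: "is_ideal UNIV"
  by (simp add: is_ideal_def)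

lemma is_ideal_dvd: "is_ideal {f. d dvd f}"
  by (simp add: is_ideal_def)

lemma is_ideal_quotient: "is_ideal I \<Longrightarrow> is_ideal {a. \<forall>b\<in>B. a * b \<in> I}"
  by (auto simp: is_ideal_def distrib_right mult.assoc)

lemma is_ideal_ideal_pow: "is_ideal (ideal_pow I n)"
  by (cases n) (simp_all add: is_ideal_UNIV is_ideal_gen_ideal)

lemmas ideal_pow_zero = ideal_zero[OF is_ideal_ideal_pow]
  and ideal_pow_add = ideal_add[OF is_ideal_ideal_pow]
  and ideal_pow_diff = ideal_diff[OF is_ideal_ideal_pow]
  and ideal_pow_multL = ideal_multL[OF is_ideal_ideal_pow]
  and ideal_pow_multR = ideal_multR[OF is_ideal_ideal_pow]

lemma ideal_pow_Suc_mult: "a \<in> I \<Longrightarrow> b \<in> ideal_pow I n \<Longrightarrow> a * b \<in> ideal_pow I (Suc n)"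
  by (auto intro!: gen_ideal_base)

text \<open>The elements multiplying \<open>B\<close> into \<open>C\<close> form an ideal, so it
  suffices to test generators.\<close>

lemma ideal_pow_Suc_subset:
  assumes "is_ideal C" and "ideal_pow (gen_ideal S) n \<subseteq> B"
    and "\<And>a b. a \<in> S \<Longrightarrow> b \<in> B \<Longrightarrow> a * b \<in> C"
  shows "ideal_pow (gen_ideal S) (Suc n) \<subseteq> C"
proof -
  have "gen_ideal S \<subseteq> {a. \<forall>b\<in>B. a * b \<in> C}"
    by (rule gen_ideal_least) (use assms in \<open>auto intro!: is_ideal_quotient\<close>)
  then show ?thesis
    using assms(2) by (auto intro!: gen_ideal_least[OF assms(1)])
qed

text \<open>Induction principle behind many inclusions below: it suffices that each generator moves
  the chain of ideals up one step.\<close>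

lemma ideal_pow_subset:
  assumes "\<And>n. is_ideal (A n)" and "A 0 = UNIV"
    and "\<And>n a b. a \<in> S \<Longrightarrow> b \<in> A n \<Longrightarrow> a * b \<in> A (Suc n)"
  shows "ideal_pow (gen_ideal S) n \<subseteq> A n"
proof (induction n)
  case (Suc n)
  show ?case by (rule ideal_pow_Suc_subset[OF assms(1) Suc assms(3)])
qed (simp add: assms(2))

lemma ideal_pow_mult:
  assumes "is_ideal I" "a \<in> ideal_pow I m" "b \<in> ideal_pow I n"
  shows "a * b \<in> ideal_pow I (m + n)"
proof -
  have *: "is_ideal {a. \<forall>b\<in>ideal_pow I n. a * b \<in> ideal_pow I (m + n)}" for m
    by (rule is_ideal_quotient[OF is_ideal_ideal_pow])
  show ?thesis
    using assms(2,3)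
  proof (induction m arbitrary: a b)
    case 0
    then show ?case by (simp add: ideal_pow_multL)
  next
    case (Suc m)
    have "ideal_pow I (Suc m) \<subseteq> {a. \<forall>b\<in>ideal_pow I n. a * b \<in> ideal_pow I (Suc m + n)}"
      unfolding ideal_pow.simps
    proof (rule gen_ideal_least[OF *], clarify)
      fix c d e assume "c \<in> I" "d \<in> ideal_pow I m" "e \<in> ideal_pow I n"
      then show "c * d * e \<in> ideal_pow I (Suc m + n)"
        using ideal_pow_Suc_mult[of c I "d * e"] Suc.IH by (simp add: mult.assoc)
    qed
    then show ?case using Suc.prems by blast
  qed
qed

lemma ideal_pow_power: "a \<in> I \<Longrightarrow> a ^ n \<in> ideal_pow I n"
  by (induction n) (auto simp del: ideal_pow.simps(2) intro: ideal_pow_Suc_mult)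

lemma ideal_pow_1:
  assumes "is_ideal I"
  shows "ideal_pow I (Suc 0) = I"
proof
  show "ideal_pow I (Suc 0) \<subseteq> I"
    unfolding ideal_pow.simps by (rule gen_ideal_least) (use assms in \<open>auto intro: ideal_multR\<close>)
  show "I \<subseteq> ideal_pow I (Suc 0)"
    using ideal_pow_Suc_mult[of _ I 1 0] by auto
qed

lemma ideal_pow_anti: "n \<le> m \<Longrightarrow> ideal_pow I m \<subseteq> ideal_pow I n"
proof (induction m rule: dec_induct)
  case (step m)
  have "ideal_pow I (Suc m) \<subseteq> ideal_pow I m"
    unfolding ideal_pow.simps by (rule gen_ideal_least) (auto intro: is_ideal_ideal_pow ideal_pow_multL)
  with step show ?case by blast
qed simp

locale rhom =
  fixes h :: "'a::comm_ring_1 \<Rightarrow> 'b::comm_ring_1"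
  assumes add: "h (a + b) = h a + h b"
    and mult: "h (a * b) = h a * h b"
    and one: "h 1 = 1"
begin

lemma zero: "h 0 = 0"
  using add[of 0 0] by simp

lemma uminus: "h (- a) = - h a"
  using add[of a "- a"] zero by (simp add: eq_neg_iff_add_eq_0 add.commute)

lemma diff: "h (a - b) = h a - h b"
  using add[of a "- b"] uminus by simp

lemma power: "h (a ^ n) = h a ^ n"
  by (induction n) (simp_all add: one mult)

lemma sum: "h (sum f A) = (\<Sum>i\<in>A. h (f i))"
  by (induction A rule: infinite_finite_induct) (simp_all add: zero add)

lemma numeral: "h (numeral n) = numeral n"
  by (induction n) (simp_all only: numeral.simps add one)

lemmas hom = add mult one zero uminus diff power numeral

lemma ideal_pow_image:
  assumes I: "\<And>a. a \<in> S \<Longrightarrow> h a \<in> I" and f: "f \<in> ideal_pow (gen_ideal S) n"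
  shows "h f \<in> ideal_pow I n"
proof -
  have "ideal_pow (gen_ideal S) n \<subseteq> {f. h f \<in> ideal_pow I n}"
  proof (rule ideal_pow_subset)
    show "is_ideal {f. h f \<in> ideal_pow I n}" for n
      by (simp add: is_ideal_def hom ideal_pow_zero ideal_pow_add ideal_pow_multL del: ideal_pow.simps)
    show "a * b \<in> {f. h f \<in> ideal_pow I (Suc n)}"
      if "a \<in> S" "b \<in> {f. h f \<in> ideal_pow I n}" for a b n
      using that ideal_pow_Suc_mult[OF I[of a], of "h b" n] by (simp add: hom del: ideal_pow.simps)
  qed simp
  then show ?thesis using f by blast
qed

text \<open>Turns order of vanishing into divisibility; later \<open>d\<close> is a deformation
  parameter or a linear form.\<close>

lemma dvd_image_ideal_pow:
  assumes d: "\<And>a. a \<in> S \<Longrightarrow> d dvd h a" and f: "f \<in> ideal_pow (gen_ideal S) n"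
  shows "d ^ n dvd h f"
proof -
  have "ideal_pow (gen_ideal S) n \<subseteq> {f. d ^ n dvd h f}"
    by (rule ideal_pow_subset) (auto simp: is_ideal_def hom mult_dvd_mono d)
  then show ?thesis using f by blast
qed

end

subsection \<open>Substitution homomorphisms\<close>

text \<open>Three nested copies of this evaluation give the substitution homomorphisms out of
  C[x][y][z], with x innermost.\<close>

definition peval :: "('a::comm_ring_1 \<Rightarrow> 'b::comm_ring_1) \<Rightarrow> 'b \<Rightarrow> 'a poly \<Rightarrow> 'b" where
  "peval h t p = poly (map_poly h p) t"

context rhom begin

lemma peval_pCons: "peval h t (pCons c p) = h c + t * peval h t p"
  by (simp add: peval_def map_poly_pCons zero)

lemma peval_0: "peval h t 0 = 0"
  by (simp add: peval_def)

lemma rhom_peval: "rhom (peval h t)"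
proof
  show add: "peval h t (p + q) = peval h t p + peval h t q" for p q
  proof (induction p q rule: poly_induct2)
    case (pCons a p b q)
    then show ?case by (simp add: peval_pCons add distrib_left)
  qed (simp add: peval_0)
  have smult: "peval h t (smult c p) = h c * peval h t p" for c p
    by (induction p) (simp_all add: peval_0 peval_pCons mult algebra_simps)
  show "peval h t (p * q) = peval h t p * peval h t q" for p q
    by (induction p) (simp_all add: peval_0 peval_pCons add smult zero algebra_simps)
  show "peval h t 1 = 1"
    by (simp add: one_pCons peval_pCons peval_0 one)
qed

end

definition subst3 :: "(complex \<Rightarrow> 'a::comm_ring_1) \<Rightarrow> 'a \<Rightarrow> 'a \<Rightarrow> 'a \<Rightarrow> cpoly3 \<Rightarrow> 'a" where
  "subst3 h a b c = peval (peval (peval h a) b) c"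

lemma rhom_subst3: "rhom h \<Longrightarrow> rhom (subst3 h a b c)"
  unfolding subst3_def by (intro rhom.rhom_peval)

lemma subst3_gens:
  assumes "rhom h"
  shows "subst3 h a b c [:[:[:k:]:]:] = h k"
    and "subst3 h a b c varX = a" "subst3 h a b c varY = b" "subst3 h a b c varZ = c"
proof -
  interpret h: rhom h by fact
  interpret h1: rhom "peval h a" by (rule h.rhom_peval)
  interpret h2: rhom "peval (peval h a) b" by (rule h1.rhom_peval)
  note simps = subst3_def varX_def varY_def varZ_def h.peval_pCons h.peval_0 h1.peval_pCons h1.peval_0
    h2.peval_pCons h2.peval_0 h.zero h.one h1.one h2.one
  show "subst3 h a b c [:[:[:k:]:]:] = h k"
    and "subst3 h a b c varX = a" "subst3 h a b c varY = b" "subst3 h a b c varZ = c"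
    by (simp_all add: simps)
qed

lemma cpoly3_induct [case_names const X Y Z add mult]:
  assumes const: "\<And>k. P [:[:[:k:]:]:]" and X: "P varX" and Y: "P varY" and Z: "P varZ"
    and add: "\<And>f g. P f \<Longrightarrow> P g \<Longrightarrow> P (f + g)" and mult: "\<And>f g. P f \<Longrightarrow> P g \<Longrightarrow> P (f * g)"
  shows "P f"
proof -
  have 1: "P [:[:f:]:]" for f
  proof (induction f)
    case 0
    then show ?case using const[of 0] by simp
  next
    case (pCons k f)
    have "[:[:pCons k f:]:] = [:[:[:k:]:]:] + varX * [:[:f:]:]"
      by (simp add: varX_def)
    then show ?case using pCons const add mult X by metis
  qed
  have 2: "P [:f:]" for f
  proof (induction f)
    case 0
    then show ?case using const[of 0] by simp
  next
    case (pCons k f)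
    have "[:pCons k f:] = [:[:k:]:] + varY * [:f:]"
      by (simp add: varY_def)
    then show ?case using pCons 1 add mult Y by metis
  qed
  show ?thesis
  proof (induction f)
    case 0
    then show ?case using const[of 0] by simp
  next
    case (pCons k f)
    have "pCons k f = [:k:] + varZ * f"
      by (simp add: varZ_def)
    then show ?case using pCons 2 add mult Z by metis
  qed
qed

lemma rhom_eqI:
  assumes "rhom g" "rhom h" "\<And>k. g [:[:[:k:]:]:] = h [:[:[:k:]:]:]"
    and "g varX = h varX" "g varY = h varY" "g varZ = h varZ"
  shows "g f = h f"
  by (induction f rule: cpoly3_induct) (simp_all add: assms rhom.add rhom.mult)

lemma rhom_comp: "rhom g \<Longrightarrow> rhom h \<Longrightarrow> rhom (\<lambda>f. g (h f))"
  by (simp add: rhom_def)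

lemma rhom_poly: "rhom (\<lambda>p. poly p t)"
  by unfold_locales simp_all

declare ideal_pow.simps(2) [simp del]

section \<open>Powers of prime elements\<close>

lemma prime_elem_power_dvd_mult:
  fixes p :: "'a::idom"
  assumes p: "prime_elem p" "\<not> p dvd a" and "p ^ n dvd a * b"
  shows "p ^ n dvd b"
  using assms(3)
proof (induction n arbitrary: b)
  case (Suc n)
  then have "p dvd a * b"
    using dvd_mult_left[of p "p ^ n"] by simp
  then obtain b' where b: "b = p * b'"
    using p by (auto simp: prime_elem_dvd_mult_iff)
  have "p * p ^ n dvd p * (a * b')"
    using Suc.prems by (simp add: b mult.left_commute)
  then have "p ^ n dvd a * b'"
    using p by (simp add: prime_elem_not_zeroI dvd_mult_cancel_left)
  from Suc.IH[OF this] show ?case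
    by (simp add: b mult_dvd_mono)
qed simp

lemma prime_elem_linear: "prime_elem [:0, 1::'a::idom:]"
proof -
  have "[:0, 1:] dvd p \<longleftrightarrow> poly p 0 = 0" for p :: "'a poly"
    using poly_eq_0_iff_dvd[of p 0] by simp
  then show ?thesis
    by (simp add: prime_elem_def)
qed

subsection \<open>Deformation along a retraction\<close>

abbreviation (input) "X \<equiv> varX"
abbreviation (input) "Y \<equiv> varY"
abbreviation (input) "Z \<equiv> varZ"

definition csub :: "cpoly3 \<Rightarrow> cpoly3 \<Rightarrow> cpoly3 \<Rightarrow> cpoly3 \<Rightarrow> cpoly3" where
  "csub = subst3 (\<lambda>k. [:[:[:k:]:]:])"

text \<open>For a linear retraction \<open>(a, b, c)\<close> the family \<open>deform\<close> joins the retraction (parameter 0) to the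
  identity (parameter 1) and multiplies each generator of the ideal by the parameter. Hence the
  power of the ideal containing \<open>f\<close> is the order of vanishing of \<open>deform f\<close> in the parameter.\<close>

definition deform :: "cpoly3 \<Rightarrow> cpoly3 \<Rightarrow> cpoly3 \<Rightarrow> cpoly3 \<Rightarrow> cpoly3 poly" where
  "deform a b c = subst3 (\<lambda>k. [:[:[:[:k:]:]:]:]) [:a, X - a:] [:b, Y - b:] [:c, Z - c:]"

lemma rhom_const: "rhom (\<lambda>k::complex. [:[:[:k:]:]:])"
  by unfold_locales (simp_all add: one_pCons)

lemma rhom_const': "rhom (\<lambda>k::complex. [:[:[:[:k:]:]:]:])"
  by unfold_locales (simp_all add: one_pCons)

interpretation csub: rhom "csub a b c"
  unfolding csub_def by (rule rhom_subst3[OF rhom_const])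

interpretation deform: rhom "deform a b c"
  unfolding deform_def by (rule rhom_subst3[OF rhom_const'])

lemma csub_gens [simp]:
  "csub a b c [:[:[:k:]:]:] = [:[:[:k:]:]:]" "csub a b c X = a" "csub a b c Y = b" "csub a b c Z = c"
  by (simp_all add: csub_def subst3_gens[OF rhom_const])

lemma deform_gens [simp]:
  "deform a b c [:[:[:k:]:]:] = [:[:[:[:k:]:]:]:]" "deform a b c X = [:a, X - a:]"
  "deform a b c Y = [:b, Y - b:]" "deform a b c Z = [:c, Z - c:]"
  by (simp_all add: deform_def subst3_gens[OF rhom_const'])

lemmas csub_simps [simp] = csub.hom
lemmas deform_simps [simp] = deform.hom

lemma rhom_id: "rhom (\<lambda>f. f)"
  by unfold_locales simp_all

lemma poly_deform_0: "poly (deform a b c f) 0 = csub a b c f"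
  by (rule rhom_eqI[OF rhom_comp[OF rhom_poly deform.rhom_axioms] csub.rhom_axioms]) simp_all

lemma poly_deform_1: "poly (deform a b c f) 1 = f"
  by (rule rhom_eqI[OF rhom_comp[OF rhom_poly deform.rhom_axioms] rhom_id]) simp_all

text \<open>A projective point is encoded by the substitution restricting polynomials to the line
  through it and the origin: \<open>(X, X, 0)\<close> is [110], and one generator is then 0. The
  triple \<open>(0, 0, 0)\<close> gives the maximal ideal of the origin.\<close>

definition ideal_at :: "cpoly3 \<Rightarrow> cpoly3 \<Rightarrow> cpoly3 \<Rightarrow> cpoly3 set" where
  "ideal_at a b c = gen_ideal {X - a, Y - b, Z - c}"

lemma is_ideal_ideal_at: "is_ideal (ideal_at a b c)"
  by (simp add: ideal_at_def is_ideal_gen_ideal)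

lemma ideal_at_gens: "X - a \<in> ideal_at a b c" "Y - b \<in> ideal_at a b c" "Z - c \<in> ideal_at a b c"
  by (auto simp: ideal_at_def intro: gen_ideal_base)

text \<open>Each variable carries its difference from the retraction with one power of the
  parameter, and exponents add up in products.\<close>

lemma coeff_deform_in: "coeff (deform a b c f) i \<in> ideal_pow (ideal_at a b c) i"
proof (induction f arbitrary: i rule: cpoly3_induct)
  case (add f g)
  then show ?case by (simp add: ideal_pow_add)
next
  case (mult f g)
  have "coeff (deform a b c f) j * coeff (deform a b c g) (i - j) \<in> ideal_pow (ideal_at a b c) i"
    if "j \<le> i" for j
    using ideal_pow_mult[OF is_ideal_ideal_at mult.IH(1)[of j] mult.IH(2)[of "i - j"]] that by simp
  then show ?case
    by (auto simp: coeff_mult intro!: ideal_sum is_ideal_ideal_pow)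
qed (auto simp: coeff_pCons ideal_pow_1 is_ideal_ideal_at ideal_at_gens ideal_pow_zero
    split: nat.split)

text \<open>Since \<open>a\<close> is fixed, the constant terms cancel in the deformation of
  \<open>X - a\<close>, leaving the parameter times \<open>X - a\<close>; likewise for the other
  generators.\<close>

locale retraction =
  fixes a b c :: cpoly3
  assumes fixed: "deform a b c a = [:a:]" "deform a b c b = [:b:]" "deform a b c c = [:c:]"
begin

lemma in_ideal_pow_iff: "f \<in> ideal_pow (ideal_at a b c) n \<longleftrightarrow> [:0, 1:] ^ n dvd deform a b c f"
proof
  assume "f \<in> ideal_pow (ideal_at a b c) n"
  then show "[:0, 1:] ^ n dvd deform a b c f"
    unfolding ideal_at_def
    by (rule deform.dvd_image_ideal_pow[rotated])
       (auto simp: fixed intro!: dvdI[of _ _ "[:_:]"])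
next
  assume "[:0, 1:] ^ n dvd deform a b c f"
  then have *: "coeff (deform a b c f) i = 0" if "i < n" for i
  proof -
    have "[:0, 1:] ^ n = (monom 1 n :: cpoly3 poly)"
      by (simp add: monom_altdef)
    with \<open>[:0, 1:] ^ n dvd deform a b c f\<close> that show ?thesis
      by (simp add: monom_1_dvd_iff')
  qed
  \<comment> \<open>At parameter 1 the deformation is \<open>f\<close>, so \<open>f\<close> is the
    sum of the coefficients. Those of index below \<open>n\<close> vanish, the others lie in the
    \<open>n\<close>-th power.\<close>
  have "f = (\<Sum>i\<le>degree (deform a b c f). coeff (deform a b c f) i)"
    using poly_deform_1[of a b c f] by (simp add: poly_altdef)
  also have "\<dots> \<in> ideal_pow (ideal_at a b c) n"
  proof (intro ideal_sum is_ideal_ideal_pow)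
    fix i
    show "coeff (deform a b c f) i \<in> ideal_pow (ideal_at a b c) n"
      using *[of i] coeff_deform_in[of a b c f i] ideal_pow_anti[of n i "ideal_at a b c"]
      by (cases "i < n") (auto simp: ideal_pow_zero)
  qed
  finally show "f \<in> ideal_pow (ideal_at a b c) n" .
qed

lemma in_ideal_iff: "f \<in> ideal_at a b c \<longleftrightarrow> csub a b c f = 0"
  using in_ideal_pow_iff[of f 1] poly_eq_0_iff_dvd[of "deform a b c f" 0]
  by (simp add: ideal_pow_1 is_ideal_ideal_at poly_deform_0)

lemma not_dvd_deform: "s \<notin> ideal_at a b c \<Longrightarrow> \<not> [:0, 1:] dvd deform a b c s"
  using poly_eq_0_iff_dvd[of "deform a b c s" 0] by (simp add: in_ideal_iff poly_deform_0)

text \<open>Powers of these ideals are primary: the parameter is prime and does not divide the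
  deformation of \<open>s\<close>, so its \<open>n\<close> factors all divide that of
  \<open>f\<close>.\<close>

lemma cancel_unit:
  assumes "s \<notin> ideal_at a b c" "s * f \<in> ideal_pow (ideal_at a b c) n"
  shows "f \<in> ideal_pow (ideal_at a b c) n"
  using prime_elem_power_dvd_mult[OF prime_elem_linear not_dvd_deform[OF assms(1)]] assms(2)
  unfolding in_ideal_pow_iff deform.mult by blast

text \<open>The deformation of \<open>l\<close> contains the parameter exactly once, so dividing by
  \<open>l\<close> costs one order.\<close>

lemma cancel_linear:
  assumes l: "deform a b c l = [:0, l:]" "l \<noteq> 0" and f: "l * f \<in> ideal_pow (ideal_at a b c) (Suc n)"
  shows "f \<in> ideal_pow (ideal_at a b c) n"
proof -
  have "[:0, 1:] * [:0, 1:] ^ n dvd [:0, 1:] * ([:l:] * deform a b c f)"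
    using f in_ideal_pow_iff[of "l * f" "Suc n"] l(1) by (simp add: mult.assoc)
  then have "[:0, 1:] ^ n dvd [:l:] * deform a b c f"
    by (subst (asm) dvd_mult_cancel_left) auto
  moreover have "\<not> [:0, 1:] dvd [:l:]"
    using poly_eq_0_iff_dvd[of "[:l:]" 0] l(2) by simp
  ultimately show ?thesis
    unfolding in_ideal_pow_iff by (rule prime_elem_power_dvd_mult[OF prime_elem_linear, rotated])
qed

end

section \<open>Linear forms and restriction to lines\<close>

lemma var_nonzero [simp]: "X \<noteq> 0" "Y \<noteq> 0" "Z \<noteq> 0"
  by (simp_all add: varX_def varY_def varZ_def)

lemma var_distinct [simp]: "X \<noteq> Y" "Y \<noteq> X" "X \<noteq> Z" "Z \<noteq> X" "Y \<noteq> Z" "Z \<noteq> Y"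
  by (simp_all add: varX_def varY_def varZ_def)

lemma csub_csub [simp]:
  "csub a b c (csub u v w f) = csub (csub a b c u) (csub a b c v) (csub a b c w) f"
  by (rule rhom_eqI[OF rhom_comp[OF csub.rhom_axioms csub.rhom_axioms] csub.rhom_axioms]) simp_all

lemma diff_csub_in: "f - csub a b c f \<in> ideal_at a b c"
proof (induction f rule: cpoly3_induct)
  case (add f g)
  then show ?case
    using ideal_add[OF is_ideal_ideal_at add.IH] by (simp add: algebra_simps)
next
  case (mult f g)
  have "f * g - csub a b c (f * g) = f * (g - csub a b c g) + (f - csub a b c f) * csub a b c g"
    by (simp add: algebra_simps)
  then show ?case
    using mult.IH by (metis ideal_add ideal_multL ideal_multR is_ideal_ideal_at)
qed (simp_all add: ideal_at_gens ideal_zero is_ideal_ideal_at)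

text \<open>Each variable agrees with its image modulo \<open>l\<close>, hence so does every
  polynomial. This splits off the restriction to the line \<open>l\<close>.\<close>

lemma dvd_diff_csub:
  assumes "l dvd X - a" "l dvd Y - b" "l dvd Z - c"
  shows "l dvd f - csub a b c f"
proof -
  have "ideal_at a b c \<subseteq> {f. l dvd f}"
    unfolding ideal_at_def
  proof (rule gen_ideal_least[OF is_ideal_dvd])
    show "{X - a, Y - b, Z - c} \<subseteq> {f. l dvd f}"
      using assms by blast
  qed
  then show ?thesis using diff_csub_in by blast
qed

lemma not_dvd_if_csub: "csub a b c l = 0 \<Longrightarrow> csub a b c f \<noteq> 0 \<Longrightarrow> \<not> l dvd f"
  by (auto elim!: dvdE)

text \<open>Used for restriction to a line, where the ideal of a point restricts to multiples of one
  linear form, and for pulling back along a map that contracts the line \<open>d\<close> to the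
  point.\<close>

lemma power_dvd_csub:
  assumes "f \<in> ideal_pow (ideal_at a b c) n"
    and "d dvd csub u v w (X - a)" "d dvd csub u v w (Y - b)" "d dvd csub u v w (Z - c)"
  shows "d ^ n dvd csub u v w f"
  using csub.dvd_image_ideal_pow[OF _ assms(1)[unfolded ideal_at_def]] assms(2-) by blast

lemma mult_power_dvd:
  fixes p q :: "'a::idom"
  assumes "prime_elem q" "\<not> q dvd p" "p ^ n dvd a" "q ^ n dvd a"
  shows "(p * q) ^ n dvd a"
proof -
  obtain b where b: "a = p ^ n * b"
    using assms(3) ..
  have "q ^ n dvd b"
    using assms prime_elem_power_dvd_mult[of q "p ^ n" n b] prime_elem_dvd_power[of q p n]
    unfolding b by blast
  then show ?thesis
    by (simp add: b power_mult_distrib mult_dvd_mono)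
qed

context retraction begin

text \<open>Divisibility by \<open>l\<close> is vanishing under the retraction, a homomorphism into
  a domain.\<close>

lemma prime_elem_if_dvd:
  assumes "l \<noteq> 0" "csub a b c l = 0" "l dvd X - a" "l dvd Y - b" "l dvd Z - c"
  shows "prime_elem l"
proof -
  have iff: "l dvd f \<longleftrightarrow> csub a b c f = 0" for f
    using dvd_diff_csub[OF assms(3-5), of f] not_dvd_if_csub[OF assms(2)]
    by (metis diff_zero)
  show ?thesis
    unfolding prime_elem_def iff using assms(1) by (simp only: csub.hom) simp
qed

lemma cancel_linear_unit:
  assumes "deform a b c l = [:0, l:]" "l \<noteq> 0" "csub a b c s \<noteq> 0"
    and "l * s * f \<in> ideal_pow (ideal_at a b c) (Suc n)"
  shows "f \<in> ideal_pow (ideal_at a b c) n"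
proof (rule cancel_unit)
  show "s \<notin> ideal_at a b c"
    using assms(3) in_ideal_iff by simp
  show "s * f \<in> ideal_pow (ideal_at a b c) n"
    using cancel_linear[OF assms(1,2)] assms(4) by (simp add: mult.assoc)
qed

end

lemma smult_two: "smult l 2 = [:2 * l:]" for l :: cpoly3
  by (simp only: numeral_poly[where 'a = cpoly3] smult_pCons smult_0_right mult.commute)

lemma retraction_points:
  "retraction X 0 0" "retraction X X 0" "retraction X 0 X" "retraction X X X"
  "retraction 0 Y 0" "retraction 0 0 Z" "retraction 0 Y Y" "retraction 0 0 0"
  by (unfold_locales; simp)+

lemma linear_nonzero: "Y - X \<noteq> 0" "Z - X \<noteq> 0" "Y - Z \<noteq> 0" "2 * Y - X \<noteq> 0" "2 * Z - X \<noteq> 0"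
  by (rule notI, drule arg_cong[of _ _ "csub 1 2 0"], simp)+

lemma prime_elem_linear_forms:
  "prime_elem X" "prime_elem Y" "prime_elem Z"
  "prime_elem (Y - X)" "prime_elem (Y - Z)" "prime_elem (2 * Y - X)" "prime_elem (2 * Z - X)"
proof -
  \<comment> \<open>One retraction per linear form, solving its equation for one variable.\<close>
  have "retraction 0 Y Z" "retraction X 0 Z" "retraction X Y 0" "retraction X X Z" "retraction X Z Z"
    "retraction (2 * Y) Y Z" "retraction (2 * Z) Y Z"
    by (unfold_locales; simp add: smult_two)+
  note * = this[THEN retraction.prime_elem_if_dvd]
  show "prime_elem X" by (rule *(1)) simp_all
  show "prime_elem Y" by (rule *(2)) simp_all
  show "prime_elem Z" by (rule *(3)) simp_all
  show "prime_elem (Y - X)" by (rule *(4)) (simp_all add: linear_nonzero)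
  show "prime_elem (Y - Z)" by (rule *(5)) (simp_all add: linear_nonzero)
  have [simp]: "l - l' dvd l' - l" for l l' :: cpoly3
    using dvd_refl[of "l - l'"] by (metis dvd_minus_iff minus_diff_eq)
  show "prime_elem (2 * Y - X)" by (rule *(6)) (simp_all add: linear_nonzero(4)[unfolded right_minus_eq])
  show "prime_elem (2 * Z - X)" by (rule *(7)) (simp_all add: linear_nonzero(5)[unfolded right_minus_eq])
qed

subsection \<open>Fat points\<close>

text \<open>For the seven points this is vanishing to order \<open>n\<close> at each of them; for
  the origin it excludes homogeneous components of degree below \<open>n\<close>.\<close>

definition fat_ideal :: "(cpoly3 \<times> cpoly3 \<times> cpoly3) set \<Rightarrow> nat \<Rightarrow> cpoly3 set" where
  "fat_ideal T n = {f. \<forall>(a, b, c)\<in>T. f \<in> ideal_pow (ideal_at a b c) n}"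

lemma is_ideal_fat_ideal: "is_ideal (fat_ideal T n)"
  unfolding is_ideal_def fat_ideal_def
  by (auto intro: ideal_pow_zero ideal_pow_add ideal_pow_multL)

lemmas fat_ideal_add = ideal_add[OF is_ideal_fat_ideal]
  and fat_ideal_diff = ideal_diff[OF is_ideal_fat_ideal]
  and fat_ideal_multR = ideal_multR[OF is_ideal_fat_ideal]

lemma fat_ideal_mult: "f \<in> fat_ideal T m \<Longrightarrow> g \<in> fat_ideal T n \<Longrightarrow> f * g \<in> fat_ideal T (m + n)"
  by (auto simp: fat_ideal_def intro!: ideal_pow_mult is_ideal_ideal_at)

lemma fat_ideal_power_mult: "f \<in> fat_ideal T d \<Longrightarrow> f ^ n \<in> fat_ideal T (d * n)"
proof (induction n)
  case 0
  then show ?case by (auto simp: fat_ideal_def)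
next
  case (Suc n)
  then show ?case using fat_ideal_mult[of f T d "f ^ n" "d * n"] by simp
qed

lemma fat_ideal_anti: "n \<le> m \<Longrightarrow> fat_ideal T m \<subseteq> fat_ideal T n"
  using ideal_pow_anti[of n m] by (fastforce simp: fat_ideal_def)

lemma ideal_pow_subset_fat_ideal:
  assumes "\<And>s. s \<in> S \<Longrightarrow> s \<in> fat_ideal T d"
  shows "ideal_pow (gen_ideal S) n \<subseteq> fat_ideal T (d * n)"
proof (rule ideal_pow_subset)
  show "fat_ideal T (d * 0) = UNIV"
    by (auto simp: fat_ideal_def)
  show "a * b \<in> fat_ideal T (d * Suc n)" if "a \<in> S" "b \<in> fat_ideal T (d * n)" for a b n
    using fat_ideal_mult[OF assms[OF that(1)] that(2)] by simp
qed (rule is_ideal_fat_ideal)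

lemma fat_ideal_cancel_unit:
  assumes "\<And>a b c. (a, b, c) \<in> T \<Longrightarrow> retraction a b c \<and> csub a b c s \<noteq> 0"
    and "s * f \<in> fat_ideal T n"
  shows "f \<in> fat_ideal T n"
  unfolding fat_ideal_def
proof clarify
  fix a b c assume abc: "(a, b, c) \<in> T"
  interpret retraction a b c using assms(1)[OF abc] by blast
  have "s * f \<in> ideal_pow (ideal_at a b c) n"
    using assms(2) abc by (auto simp: fat_ideal_def)
  then show "f \<in> ideal_pow (ideal_at a b c) n"
    using assms(1)[OF abc] by (auto intro: cancel_unit simp: in_ideal_iff)
qed

lemma fat_ideal_cancel_linear:
  assumes "\<And>a b c. (a, b, c) \<in> T \<Longrightarrow> retraction a b c \<and> deform a b c l = [:0, l:]"
    and "l \<noteq> 0" "l * f \<in> fat_ideal T (Suc n)"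
  shows "f \<in> fat_ideal T n"
  using assms unfolding fat_ideal_def by (fast dest: retraction.cancel_linear)

subsection \<open>The complete intersection of the four points off the line \<open>X = 0\<close>\<close>

definition four_points :: "(cpoly3 \<times> cpoly3 \<times> cpoly3) set" where
  "four_points = {(X, 0, 0), (X, X, 0), (X, 0, X), (X, X, X)}"

definition line_points :: "(cpoly3 \<times> cpoly3 \<times> cpoly3) set" where
  "line_points = {(0, Y, 0), (0, 0, Z), (0, Y, Y)}"

definition K :: "cpoly3 set" where
  "K = gen_ideal {Z * (Z - X), Y * (Y - X)}"

lemma K_gens: "Z * (Z - X) \<in> K" "Y * (Y - X) \<in> K"
  by (auto simp: K_def intro: gen_ideal_base)

lemma is_ideal_K: "is_ideal K"
  by (simp add: K_def is_ideal_gen_ideal)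

lemma in_fat_ideal_1:
  "f \<in> fat_ideal four_points (Suc 0) \<longleftrightarrow>
     csub X 0 0 f = 0 \<and> csub X X 0 f = 0 \<and> csub X 0 X f = 0 \<and> csub X X X f = 0"
  "f \<in> fat_ideal line_points (Suc 0) \<longleftrightarrow>
     csub 0 Y 0 f = 0 \<and> csub 0 0 Z f = 0 \<and> csub 0 Y Y f = 0"
  "f \<in> fat_ideal {(0, 0, 0)} (Suc 0) \<longleftrightarrow> csub 0 0 0 f = 0"
  by (simp_all add: fat_ideal_def four_points_def line_points_def ideal_pow_1 is_ideal_ideal_at
      retraction_points[THEN retraction.in_ideal_iff])

text \<open>The lines \<open>Z = 0\<close> and \<open>Z = X\<close> contain two of the points each.
  Interpolating \<open>f\<close> on them gives a multiple of \<open>w ^ Suc n\<close> plus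
  \<open>Z * (Z - X) * q\<close>, where \<open>q\<close> vanishes to one order less.\<close>

lemma fat_four_points_subset: "f \<in> fat_ideal four_points n \<Longrightarrow> f \<in> ideal_pow K n"
proof (induction n arbitrary: f)
  case (Suc n)
  have f: "f \<in> ideal_pow (ideal_at X 0 0) (Suc n)" "f \<in> ideal_pow (ideal_at X X 0) (Suc n)"
    "f \<in> ideal_pow (ideal_at X 0 X) (Suc n)" "f \<in> ideal_pow (ideal_at X X X) (Suc n)"
    using Suc.prems by (auto simp: fat_ideal_def four_points_def)
  define w where "w = Y * (Y - X)"
  define a where "a = csub X Y 0 f"
  have "Z dvd f - a"
    unfolding a_def by (rule dvd_diff_csub) simp_all
  then obtain f1 where f1: "f - a = Z * f1" ..
  \<comment> \<open>Newton interpolation in \<open>Z\<close> at the nodes 0 and \<open>X\<close>: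
    \<open>a\<close> and \<open>b\<close> are free of \<open>Z\<close>.\<close>
  define b where "b = csub X Y X f1"
  have "Z - X dvd f1 - b"
    unfolding b_def by (rule dvd_diff_csub) simp_all
  then obtain q where q: "f1 - b = (Z - X) * q" ..
  have "f = a + Z * f1" "f1 = b + (Z - X) * q"
    using f1 q by (simp_all only: diff_eq_eq add.commute)
  then have f_eq: "f = a + Z * b + Z * (Z - X) * q"
    by (simp add: algebra_simps)
  have ndvd: "\<not> Y - X dvd Y" "\<not> Y dvd X" "\<not> Y - X dvd X"
    using not_dvd_if_csub[of X X Z "Y - X" Y] not_dvd_if_csub[of X 0 Z Y X]
      not_dvd_if_csub[of X X Z "Y - X" X] by simp_all
  have e: "csub X Y X f = a + X * b"
  proof -
    have "csub X Y X a = a" "csub X Y X b = b"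
      by (simp_all add: a_def b_def)
    then show ?thesis
      using arg_cong[OF f_eq, of "csub X Y X"] by simp
  qed
  have wa: "w ^ Suc n dvd a"
    unfolding w_def a_def
    by (rule mult_power_dvd[OF prime_elem_linear_forms(4) ndvd(1)
          power_dvd_csub[OF f(1)] power_dvd_csub[OF f(2)]]) simp_all
  have we: "w ^ Suc n dvd csub X Y X f"
    unfolding w_def
    by (rule mult_power_dvd[OF prime_elem_linear_forms(4) ndvd(1)
          power_dvd_csub[OF f(3)] power_dvd_csub[OF f(4)]]) simp_all
  have "w ^ Suc n dvd X * b"
    using we wa unfolding e by (simp add: dvd_add_right_iff)
  then have wX: "Y ^ Suc n dvd X * b" "(Y - X) ^ Suc n dvd X * b"
    unfolding w_def power_mult_distrib by (blast dest: dvd_mult_left dvd_mult_right)+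
  have wb: "w ^ Suc n dvd b"
    unfolding w_def
    by (rule mult_power_dvd[OF prime_elem_linear_forms(4) ndvd(1)
        prime_elem_power_dvd_mult[OF prime_elem_linear_forms(2) ndvd(2) wX(1)]
        prime_elem_power_dvd_mult[OF prime_elem_linear_forms(4) ndvd(3) wX(2)]])
  have w_fat: "w ^ Suc n \<in> fat_ideal four_points (Suc n)"
    using fat_ideal_power_mult[of w four_points "Suc 0" "Suc n"] by (simp add: in_fat_ideal_1 w_def)
  have "w ^ Suc n dvd a + Z * b"
    using wa wb by (simp add: dvd_mult)
  then have ab: "a + Z * b \<in> fat_ideal four_points (Suc n)"
    using fat_ideal_multR[OF w_fat] by (auto elim: dvdE)
  have "Z * (Z - X) * q \<in> fat_ideal four_points (Suc n)"
    using fat_ideal_diff[OF Suc.prems ab] by (simp add: f_eq)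
  \<comment> \<open>At each point exactly one of the two factors vanishes; it is written first, to
    be cancelled at the cost of one order.\<close>
  then have Zq: "Z * (Z - X) * q \<in> ideal_pow (ideal_at X 0 0) (Suc n)"
    "Z * (Z - X) * q \<in> ideal_pow (ideal_at X X 0) (Suc n)"
    "(Z - X) * Z * q \<in> ideal_pow (ideal_at X 0 X) (Suc n)"
    "(Z - X) * Z * q \<in> ideal_pow (ideal_at X X X) (Suc n)"
    by (simp_all add: fat_ideal_def four_points_def mult.commute[of "Z - X" Z])
  note c = retraction_points[THEN retraction.cancel_linear_unit]
  have "q \<in> fat_ideal four_points n"
    unfolding fat_ideal_def four_points_def
    using c(1)[OF _ _ _ Zq(1)] c(2)[OF _ _ _ Zq(2)] c(3)[OF _ _ _ Zq(3)] c(4)[OF _ _ _ Zq(4)]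
    by simp
  then have "Z * (Z - X) * q \<in> ideal_pow K (Suc n)"
    by (intro ideal_pow_Suc_mult K_gens Suc.IH)
  moreover have "a + Z * b \<in> ideal_pow K (Suc n)"
    using \<open>w ^ Suc n dvd a + Z * b\<close> ideal_pow_multR[OF ideal_pow_power[OF K_gens(2), of "Suc n"]]
    by (auto simp: w_def elim: dvdE)
  ultimately show ?case
    unfolding f_eq by (rule ideal_pow_add[rotated])
qed simp

lemma K_pow_subset_four_points: "ideal_pow K n \<subseteq> fat_ideal four_points n"
proof -
  have "ideal_pow K n \<subseteq> fat_ideal four_points (1 * n)"
    unfolding K_def
    by (rule ideal_pow_subset_fat_ideal) (auto simp: in_fat_ideal_1)
  then show ?thesis by simp
qed

lemma var_in_fat_origin: "X \<in> fat_ideal {(0, 0, 0)} (Suc 0)" "Y \<in> fat_ideal {(0, 0, 0)} (Suc 0)"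
  "Z \<in> fat_ideal {(0, 0, 0)} (Suc 0)"
  by (simp_all add: in_fat_ideal_1)

lemmas origin_1 = var_in_fat_origin fat_ideal_add fat_ideal_diff

lemma origin_mult2:
  "f \<in> fat_ideal T (Suc 0) \<Longrightarrow> g \<in> fat_ideal T (Suc 0) \<Longrightarrow> f * g \<in> fat_ideal T 2"
  using fat_ideal_mult[of f T "Suc 0" g "Suc 0"] by (simp add: numeral_2_eq_2)

lemma K_pow_subset_origin: "ideal_pow K n \<subseteq> fat_ideal {(0, 0, 0)} (2 * n)"
proof -
  have "Z * (Z - X) \<in> fat_ideal {(0, 0, 0)} 2" "Y * (Y - X) \<in> fat_ideal {(0, 0, 0)} 2"
    by (intro origin_mult2 origin_1)+
  then show ?thesis
    unfolding K_def by (intro ideal_pow_subset_fat_ideal) blast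
qed

text \<open>Modulo \<open>X\<close> the generators of \<open>K\<close> become \<open>Z\<^sup>2\<close> and \<open>Y\<^sup>2\<close>, and an odd power
  of \<open>(Y, Z)\<close> is \<open>(Y, Z)\<close> times a power of \<open>(Y\<^sup>2, Z\<^sup>2)\<close>.\<close>

lemma lift_odd_power:
  assumes "f \<in> ideal_pow (ideal_at X 0 0) (2 * k + 1)"
  shows "\<exists>g\<in>ideal_pow K k. \<exists>h\<in>ideal_pow K k. X dvd f - (Y * g + Z * h)"
proof -
  \<comment> \<open>\<open>A k\<close> is the ideal (X) + (Y, Z) K^k.\<close>
  define A where "A k = {f. \<exists>g\<in>ideal_pow K k. \<exists>h\<in>ideal_pow K k. X dvd f - (Y * g + Z * h)}" for k
  have AI: "f \<in> A k"
    if "g \<in> ideal_pow K k" "h \<in> ideal_pow K k" "f = Y * g + Z * h + X * u" for f g h u k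
    unfolding A_def using that(1,2) by (intro CollectI bexI[of _ g] bexI[of _ h]) (simp_all add: that(3))
  have AE: thesis
    if "f \<in> A k"
      "\<And>g h u. g \<in> ideal_pow K k \<Longrightarrow> h \<in> ideal_pow K k \<Longrightarrow> f = Y * g + Z * h + X * u \<Longrightarrow> thesis"
    for f k thesis
  proof -
    obtain g h where gh: "g \<in> ideal_pow K k" "h \<in> ideal_pow K k" "X dvd f - (Y * g + Z * h)"
      using \<open>f \<in> A k\<close> unfolding A_def by blast
    then obtain u where "f - (Y * g + Z * h) = X * u" by (elim dvdE)
    then have "f = Y * g + Z * h + X * u" by (simp add: algebra_simps)
    then show ?thesis using that(2) gh by blast
  qed
  have A: "is_ideal (A k)" for k
    unfolding is_ideal_def
  proof (intro conjI ballI allI)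
    show "0 \<in> A k" by (rule AI[of 0 _ 0 _ 0]) (simp_all add: ideal_pow_zero)
    show "f + f' \<in> A k" if "f \<in> A k" "f' \<in> A k" for f f'
    proof (rule AE[OF that(1)], rule AE[OF that(2)])
      fix g h u g' h' u'
      assume *: "g \<in> ideal_pow K k" "h \<in> ideal_pow K k" "f = Y * g + Z * h + X * u"
        "g' \<in> ideal_pow K k" "h' \<in> ideal_pow K k" "f' = Y * g' + Z * h' + X * u'"
      show ?thesis
        by (rule AI[of "g + g'" _ "h + h'" _ "u + u'"]) (use * in \<open>auto intro: ideal_pow_add simp: algebra_simps\<close>)
    qed
    show "r * f \<in> A k" if "f \<in> A k" for f r
    proof (rule AE[OF that])
      fix g h u
      assume *: "g \<in> ideal_pow K k" "h \<in> ideal_pow K k" "f = Y * g + Z * h + X * u"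
      show ?thesis
        by (rule AI[of "r * g" _ "r * h" _ "r * u"]) (use * in \<open>auto intro: ideal_pow_multL simp: distrib_left mult.left_commute\<close>)
    qed
  qed
  have AX: "X * v \<in> A k" for v k
    by (rule AI[of 0 _ 0 _ v]) (simp_all add: ideal_pow_zero)
  have step: "s * (t * f) \<in> A (Suc k)"
    if f: "f \<in> A k" and st: "s \<in> {X - X, Y - 0, Z - 0}" "t \<in> {X - X, Y - 0, Z - 0}" for f k s t
  proof (rule AE[OF f])
    fix g h u
    assume gh: "g \<in> ideal_pow K k" "h \<in> ideal_pow K k" and f: "f = Y * g + Z * h + X * u"
    define c d where "c = Y * (Y - X)" and "d = Z * (Z - X)"
    have K: "c * g \<in> ideal_pow K (Suc k)" "c * h \<in> ideal_pow K (Suc k)"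
      "d * g \<in> ideal_pow K (Suc k)" "d * h \<in> ideal_pow K (Suc k)"
      using gh K_gens by (auto simp: c_def d_def intro: ideal_pow_Suc_mult)
    \<comment> \<open>Modulo \<open>X\<close>, \<open>Y * Y\<close> is \<open>c\<close> and
      \<open>Z * Z\<close> is \<open>d\<close>; the mixed product
      \<open>Y * Z * (Y * g + Z * h)\<close> becomes
      \<open>Z * (c * g) + Y * (d * h)\<close>.\<close>
    have yy: "Y * (Y * f) \<in> A (Suc k)"
      by (rule AI[OF K(1,2), of _ "Y * (Y * g + Z * h) + Y * Y * u"]) (simp add: f c_def algebra_simps)
    have zz: "Z * (Z * f) \<in> A (Suc k)"
      by (rule AI[OF K(3,4), of _ "Z * (Y * g + Z * h) + Z * Z * u"]) (simp add: f d_def algebra_simps)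
    have yz: "Y * (Z * f) \<in> A (Suc k)"
      by (rule AI[OF K(4) K(1), of _ "Y * Z * (g + h) + Y * Z * u"]) (simp add: f c_def d_def algebra_simps)
    have zy: "Z * (Y * f) \<in> A (Suc k)"
      using yz by (simp add: mult.left_commute)
    from st show ?thesis
      using yy zz yz zy ideal_zero[OF A] by auto
  qed
  have "ideal_pow (ideal_at X 0 0) (2 * k + 1) \<subseteq> A k"
  proof (induction k)
    case 0
    have "ideal_at X 0 0 \<subseteq> A 0"
      unfolding ideal_at_def
    proof (rule gen_ideal_least[OF A])
      show "{X - X, Y - 0, Z - 0} \<subseteq> A 0"
        using AI[of 0 0 0 0 0] AI[of 1 0 0 Y 0] AI[of 0 0 1 Z 0] by simp
    qed
    then show ?case
      by (simp add: ideal_pow_1 is_ideal_ideal_at)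
  next
    case (Suc k)
    let ?S = "{X - X, Y - 0, Z - 0}"
    have B: "is_ideal {f. \<forall>s\<in>?S. f * s \<in> A (Suc k)}"
      by (rule is_ideal_quotient[OF A])
    \<comment> \<open>Passing from \<open>A k\<close> to \<open>A (Suc k)\<close> takes two factors;
      the target after the first one is a quotient ideal.\<close>
    have "ideal_pow (ideal_at X 0 0) (Suc (2 * k + 1)) \<subseteq> {f. \<forall>s\<in>?S. f * s \<in> A (Suc k)}"
      unfolding ideal_at_def
    proof (rule ideal_pow_Suc_subset[OF B Suc.IH[unfolded ideal_at_def]])
      show "a * b \<in> {f. \<forall>s\<in>?S. f * s \<in> A (Suc k)}" if "a \<in> ?S" "b \<in> A k" for a b
        using step[OF that(2) _ that(1)] by (simp only: mem_Collect_eq mult.commute[of "a * b"]) blast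
    qed
    then have "ideal_pow (ideal_at X 0 0) (Suc (Suc (2 * k + 1))) \<subseteq> A (Suc k)"
      unfolding ideal_at_def
    proof (rule ideal_pow_Suc_subset[OF A])
      show "a * b \<in> A (Suc k)" if "a \<in> ?S" "b \<in> {f. \<forall>s\<in>?S. f * s \<in> A (Suc k)}" for a b
        using that unfolding mem_Collect_eq mult.commute[of a b] by blast
    qed
    then show ?case by simp
  qed
  then show ?thesis
    using assms unfolding A_def by blast
qed

abbreviation (input) "F \<equiv> Y * Z * (Y - Z)"

subsection \<open>The ideal of the seven points\<close>

definition J7 :: "cpoly3 set" where
  "J7 = gen_ideal {F, Z * X * (Z - X), X * Y * (X - Y)}"

lemma is_ideal_J7: "is_ideal J7"
  by (simp add: J7_def is_ideal_gen_ideal)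

lemma J7_gens: "F \<in> J7" "Z * X * (Z - X) \<in> J7" "X * Y * (X - Y) \<in> J7"
  by (auto simp: J7_def intro: gen_ideal_base)

text \<open>\<open>X\<close> times a generator of \<open>K\<close> is, up to sign, a generator of
  \<open>J7\<close>.\<close>

lemma power_X_K_subset: "f \<in> ideal_pow K n \<Longrightarrow> X ^ n * f \<in> ideal_pow J7 n"
proof -
  have gens: "X * a \<in> J7" if "a \<in> {Z * (Z - X), Y * (Y - X)}" for a
  proof -
    have eq: "X * (Z * (Z - X)) = Z * X * (Z - X)" "X * (Y * (Y - X)) = - (X * Y * (X - Y))"
      by (simp_all add: algebra_simps)
    have "X * (Z * (Z - X)) \<in> J7" "X * (Y * (Y - X)) \<in> J7"
      unfolding eq by (rule J7_gens ideal_uminus[OF is_ideal_J7 J7_gens(3)])+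
    then show ?thesis
      using that by blast
  qed
  have "ideal_pow K n \<subseteq> {f. X ^ n * f \<in> ideal_pow J7 n}"
    unfolding K_def
  proof (rule ideal_pow_subset)
    show "is_ideal {f. X ^ n * f \<in> ideal_pow J7 n}" for n
      by (auto simp: is_ideal_def distrib_left mult.left_commute[of "X ^ n"]
          intro: ideal_pow_zero ideal_pow_add ideal_pow_multL)
    show "a * b \<in> {f. X ^ Suc n * f \<in> ideal_pow J7 (Suc n)}"
      if a: "a \<in> {Z * (Z - X), Y * (Y - X)}" and "b \<in> {f. X ^ n * f \<in> ideal_pow J7 n}" for a b n
    proof -
      have "X * a * (X ^ n * b) \<in> ideal_pow J7 (Suc n)"
        using gens[OF a] that(2) by (intro ideal_pow_Suc_mult) simp_all
      moreover have "X * a * (X ^ n * b) = X ^ Suc n * (a * b)"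
        by (simp add: mult_ac)
      ultimately show ?thesis by simp
    qed
  qed simp
  then show "f \<in> ideal_pow K n \<Longrightarrow> X ^ n * f \<in> ideal_pow J7 n" by blast
qed

lemma restrict_line:
  assumes "f \<in> fat_ideal line_points n"
  obtains h where "csub 0 Y Z f = F ^ n * csub 0 Y Z h"
proof -
  have f: "f \<in> ideal_pow (ideal_at 0 Y 0) n" "f \<in> ideal_pow (ideal_at 0 0 Z) n"
    "f \<in> ideal_pow (ideal_at 0 Y Y) n"
    using assms by (simp_all add: fat_ideal_def line_points_def)
  \<comment> \<open>[001] yields the factor \<open>Y\<close>, [010] the factor \<open>Z\<close>, and
    [011] the factor \<open>Y - Z\<close>.\<close>
  have Yn: "Y ^ n dvd csub 0 Y Z f"
    by (rule power_dvd_csub[OF f(2)]) simp_all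
  have Zn: "Z ^ n dvd csub 0 Y Z f"
    by (rule power_dvd_csub[OF f(1)]) simp_all
  have "Y - Z dvd Z - Y"
    using dvd_refl[of "Y - Z"] by (metis dvd_minus_iff minus_diff_eq)
  then have YZn: "(Y - Z) ^ n dvd csub 0 Y Z f"
    by (intro power_dvd_csub[OF f(3)]) simp_all
  have ndvd: "\<not> Z dvd Y" "\<not> Y - Z dvd Y * Z"
    using not_dvd_if_csub[of X Y 0 Z Y] not_dvd_if_csub[of X Y Y "Y - Z" "Y * Z"] by simp_all
  have "F ^ n dvd csub 0 Y Z f"
    by (rule mult_power_dvd[OF prime_elem_linear_forms(5) ndvd(2)
          mult_power_dvd[OF prime_elem_linear_forms(3) ndvd(1) Yn Zn] YZn])
  then obtain h where h: "csub 0 Y Z f = F ^ n * h" ..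
  \<comment> \<open>Substituting once more makes the cofactor free of \<open>X\<close>.\<close>
  have "csub 0 Y Z f = csub 0 Y Z (csub 0 Y Z f)"
    by simp
  also have "\<dots> = F ^ n * csub 0 Y Z h"
    unfolding h by simp
  finally show ?thesis by (rule that)
qed

text \<open>\<open>X\<close> vanishes at none of the four points, so it is a nonzerodivisor modulo
  the powers of \<open>K\<close>, which are the fat-point ideals.\<close>

lemma K_pow_divide_X:
  assumes "f \<in> ideal_pow K n" "csub 0 Y Z f = 0"
  obtains g where "f = X * g" "g \<in> ideal_pow K n"
proof -
  have "X dvd f"
    using dvd_diff_csub[of X 0 Y Z f] assms(2) by simp
  then obtain g where g: "f = X * g" ..
  have "X * g \<in> fat_ideal four_points n"
    using assms(1) K_pow_subset_four_points unfolding g by blast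
  then have "g \<in> fat_ideal four_points n"
    by (rule fat_ideal_cancel_unit[rotated]) (auto simp: four_points_def retraction_points)
  then show ?thesis
    using g fat_four_points_subset that by blast
qed

lemma cancel_X_line: "X * f \<in> fat_ideal line_points (Suc n) \<Longrightarrow> f \<in> fat_ideal line_points n"
  by (rule fat_ideal_cancel_linear[where l = X]) (auto simp: line_points_def retraction_points)

lemma cancel_linear_origin:
  assumes "deform 0 0 0 l = [:0, l:]" "l \<noteq> 0" "l * f \<in> fat_ideal {(0, 0, 0)} (Suc n)"
  shows "f \<in> fat_ideal {(0, 0, 0)} n"
  by (rule fat_ideal_cancel_linear[OF _ assms(2,3)]) (auto simp: assms(1) retraction_points)

lemma cancel_F_origin:
  "F ^ i * f \<in> fat_ideal {(0, 0, 0)} (n + 3 * i) \<Longrightarrow> f \<in> fat_ideal {(0, 0, 0)} n"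
proof (induction i arbitrary: n)
  case (Suc i)
  have "Y * (Z * ((Y - Z) * (F ^ i * f))) \<in> fat_ideal {(0, 0, 0)} (Suc (Suc (Suc (n + 3 * i))))"
  proof -
    have "n + 3 * Suc i = Suc (Suc (Suc (n + 3 * i)))" by simp
    with Suc.prems show ?thesis by (simp only: power_Suc mult.assoc)
  qed
  then have "F ^ i * f \<in> fat_ideal {(0, 0, 0)} (n + 3 * i)"
    by (rule cancel_linear_origin[rotated 2, THEN cancel_linear_origin[rotated 2],
          THEN cancel_linear_origin[rotated 2]]) (simp_all add: linear_nonzero)
  then show ?case by (rule Suc.IH)
qed simp

lemma F_in_K: "F \<in> K"
proof -
  have "F = Z * (Y * (Y - X)) - Y * (Z * (Z - X))"
    by (simp add: algebra_simps)
  then show ?thesis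
    using K_gens is_ideal_K by (simp only: ideal_diff ideal_multL)
qed

lemma F_in_line_points: "F \<in> fat_ideal line_points (Suc 0)"
  by (simp add: in_fat_ideal_1)

lemma origin_mult3:
  "f \<in> fat_ideal T (Suc 0) \<Longrightarrow> g \<in> fat_ideal T (Suc 0) \<Longrightarrow> h \<in> fat_ideal T (Suc 0) \<Longrightarrow>
    f * g * h \<in> fat_ideal T 3"
  using fat_ideal_mult[of "f * g" T 2 h "Suc 0"] origin_mult2[of f T g] by simp

lemma F_power_in_origin: "F ^ n \<in> fat_ideal {(0, 0, 0)} (3 * n)"
  by (intro fat_ideal_power_mult origin_mult3 origin_1)

lemma ideal_at_image:
  assumes "f \<in> ideal_pow (ideal_at a b c) n" "csub u v w (X - a) \<in> I"
    "csub u v w (Y - b) \<in> I" "csub u v w (Z - c) \<in> I"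
  shows "csub u v w f \<in> ideal_pow I n"
  using csub.ideal_pow_image[OF _ assms(1)[unfolded ideal_at_def]] assms(2-) by blast

text \<open>Restricted to \<open>X = 0\<close>, \<open>f\<close> is \<open>F\<^sup>j h\<close>; the degree bound lets \<open>h\<close> be lifted to a power of \<open>K\<close>, and
  subtracting \<open>F\<^sup>j\<close> times the lift leaves a multiple of \<open>X\<close>.\<close>

lemma power_X_mult_in_J7_pow:
  assumes "j \<le> r" "f \<in> ideal_pow K r" "f \<in> fat_ideal line_points j"
    "f \<in> fat_ideal {(0, 0, 0)} (2 * r + j + 1)"
  shows "X ^ (r - j) * f \<in> ideal_pow J7 r"
  using assms
proof (induction j arbitrary: f)
  case 0
  then show ?case by (simp add: power_X_K_subset)
next
  case (Suc j)
  obtain k where r: "r = k + Suc j"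
    using Suc.prems(1) by (metis add.commute le_iff_add)
  let ?o = "{(0::cpoly3, 0::cpoly3, 0::cpoly3)}"
  obtain h where h: "csub 0 Y Z f = F ^ Suc j * csub 0 Y Z h"
    using restrict_line[OF Suc.prems(3)] .
  define h0 where "h0 = csub 0 Y Z h"
  have f_o: "csub 0 Y Z f \<in> fat_ideal ?o (2 * r + Suc j + 1)"
  proof -
    have "f \<in> ideal_pow (ideal_at 0 0 0) (2 * r + Suc j + 1)"
      using Suc.prems(4) by (simp add: fat_ideal_def)
    then have "csub 0 Y Z f \<in> ideal_pow (ideal_at 0 0 0) (2 * r + Suc j + 1)"
      by (rule ideal_at_image) (simp_all add: retraction_points(8)[THEN retraction.in_ideal_iff])
    then show ?thesis by (simp add: fat_ideal_def)
  qed
  \<comment> \<open>The power of \<open>F\<close> accounts for \<open>3 * Suc j\<close> orders. What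
    is left is \<open>2 * k + 1\<close>, the odd exponent of \<open>lift_odd_power\<close>.\<close>
  have "F ^ Suc j * h0 \<in> fat_ideal ?o ((2 * k + 1) + 3 * Suc j)"
  proof -
    have "2 * r + Suc j + 1 = (2 * k + 1) + 3 * Suc j"
      by (simp add: r)
    then show ?thesis
      using f_o by (simp only: h h0_def)
  qed
  then have "h0 \<in> fat_ideal ?o (2 * k + 1)"
    by (rule cancel_F_origin)
  then have h0_o: "h0 \<in> ideal_pow (ideal_at 0 0 0) (2 * k + 1)"
    by (simp add: fat_ideal_def)
  \<comment> \<open>\<open>h0\<close> is free of \<open>X\<close>, so its order at the origin bounds
    its order at [100].\<close>
  have "csub 0 Y Z h0 \<in> ideal_pow (ideal_at X 0 0) (2 * k + 1)"
    by (rule ideal_at_image[OF h0_o]) (simp_all add: retraction_points(1)[THEN retraction.in_ideal_iff])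
  then have "h0 \<in> ideal_pow (ideal_at X 0 0) (2 * k + 1)"
    by (simp add: h0_def)
  then obtain g1 g2 where g: "g1 \<in> ideal_pow K k" "g2 \<in> ideal_pow K k" "X dvd h0 - (Y * g1 + Z * g2)"
    using lift_odd_power by blast
  define G where "G = Y * g1 + Z * g2"
  have G_K: "G \<in> ideal_pow K k"
    unfolding G_def by (intro ideal_pow_add ideal_pow_multL g)
  have G_o: "G \<in> fat_ideal ?o (2 * k + 1)"
    unfolding G_def using g(1,2) K_pow_subset_origin[of k]
      fat_ideal_mult[OF var_in_fat_origin(2), of g1 "2 * k"] fat_ideal_mult[OF var_in_fat_origin(3), of g2 "2 * k"]
    by (auto intro: fat_ideal_add)
  obtain u where "h0 - G = X * u"
    using g(3) unfolding G_def ..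
  then have "csub 0 Y Z (h0 - G) = 0"
    by (simp only: csub.mult csub_gens mult_zero_left)
  then have G_h0: "csub 0 Y Z G = h0"
    by (simp add: h0_def)
  define f1 where "f1 = f - F ^ Suc j * G"
  have FK: "F ^ Suc j * G \<in> ideal_pow K r"
    using ideal_pow_mult[OF is_ideal_K ideal_pow_power[OF F_in_K, of "Suc j"] G_K]
    by (simp add: r add.commute)
  have "csub 0 Y Z f1 = 0"
    by (simp add: f1_def G_h0 h h0_def)
  moreover have "f1 \<in> ideal_pow K r"
    unfolding f1_def by (intro ideal_pow_diff Suc.prems FK)
  ultimately obtain f2 where f2: "f1 = X * f2" "f2 \<in> ideal_pow K r"
    using K_pow_divide_X by blast
  \<comment> \<open>Dividing by \<open>X\<close> costs one order at the line points and one at the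
    origin, leaving exactly the bounds for \<open>j\<close>.\<close>
  have "f1 \<in> fat_ideal line_points (Suc j)"
    unfolding f1_def
    using fat_ideal_power_mult[OF F_in_line_points, of "Suc j"] Suc.prems(3)
    by (intro fat_ideal_diff fat_ideal_multR) (simp_all only: mult_Suc mult_0 add_Suc add_0 add_0_right)
  then have f2_l: "f2 \<in> fat_ideal line_points j"
    unfolding f2 by (rule cancel_X_line)
  have "F ^ Suc j * G \<in> fat_ideal ?o (2 * r + Suc j + 1)"
  proof -
    have "2 * r + Suc j + 1 = 3 * Suc j + (2 * k + 1)"
      by (simp add: r)
    then show ?thesis
      using fat_ideal_mult[OF F_power_in_origin[of "Suc j"] G_o] by (simp only:)
  qed
  then have "f1 \<in> fat_ideal ?o (Suc (2 * r + j + 1))"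
    unfolding f1_def using Suc.prems(4) by (intro fat_ideal_diff) simp_all
  then have "f2 \<in> fat_ideal ?o (2 * r + j + 1)"
    unfolding f2 by (rule cancel_linear_origin[rotated 2]) simp_all
  then have IH: "X ^ Suc k * f2 \<in> ideal_pow J7 r"
    using Suc.IH[OF _ f2(2) f2_l] by (simp add: r Suc_diff_le)
  \<comment> \<open>\<open>F\<close> supplies \<open>Suc j\<close> factors in \<open>J7\<close>, and
    \<open>X ^ k * G\<close> the remaining \<open>k\<close>.\<close>
  have "F ^ Suc j * (X ^ k * G) \<in> ideal_pow J7 (Suc j + k)"
    by (intro ideal_pow_mult is_ideal_J7 ideal_pow_power J7_gens power_X_K_subset G_K)
  then have "X ^ Suc k * f2 + F ^ Suc j * (X ^ k * G) \<in> ideal_pow J7 r"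
    using IH by (intro ideal_pow_add) (simp_all add: r add.commute)
  moreover have "X ^ Suc k * f2 + F ^ Suc j * (X ^ k * G) = X ^ k * f"
  proof -
    have "f = X * f2 + F ^ Suc j * G"
      using f2(1) by (simp only: f1_def diff_eq_eq)
    then show ?thesis by (simp only: power_Suc distrib_left mult_ac)
  qed
  ultimately show ?case by (simp add: r)
qed

text \<open>For \<open>j = r\<close> the power of \<open>X\<close> is trivial and the order bound is
  \<open>3 * r + 1\<close>.\<close>

lemma in_J7_pow:
  assumes "f \<in> fat_ideal four_points r" "f \<in> fat_ideal line_points r"
    "f \<in> fat_ideal {(0, 0, 0)} (3 * r + 1)"
  shows "f \<in> ideal_pow J7 r"
  using power_X_mult_in_J7_pow[OF order_refl fat_four_points_subset] assms by simp

text \<open>\<open>J7\<close> is the full radical ideal of the points: restricted to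
  \<open>X = 0\<close>, \<open>f\<close> is a multiple of \<open>F\<close>, and subtracting that
  multiple leaves \<open>X\<close> times an element of \<open>K\<close>.\<close>

lemma in_J7:
  assumes "f \<in> fat_ideal four_points (Suc 0)" "f \<in> fat_ideal line_points (Suc 0)"
  shows "f \<in> J7"
proof -
  obtain h where h: "csub 0 Y Z f = F ^ Suc 0 * csub 0 Y Z h"
    using restrict_line[OF assms(2)] .
  define h0 where "h0 = csub 0 Y Z h"
  have fK: "f \<in> K"
    using fat_four_points_subset[OF assms(1)] by (simp add: ideal_pow_1 is_ideal_K)
  have "f - F * h0 \<in> ideal_pow K (Suc 0)"
    unfolding ideal_pow_1[OF is_ideal_K]
    by (rule ideal_diff[OF is_ideal_K fK ideal_multR[OF is_ideal_K F_in_K]])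
  moreover have "csub 0 Y Z (f - F * h0) = 0"
    using h by (simp add: h0_def)
  ultimately obtain g where g: "f - F * h0 = X * g" "g \<in> ideal_pow K (Suc 0)"
    using K_pow_divide_X by blast
  have "X * g \<in> J7"
    using power_X_K_subset[OF g(2)] by (simp add: ideal_pow_1 is_ideal_J7)
  moreover have "f = X * g + F * h0"
    using g(1) by (simp only: diff_eq_eq)
  ultimately show ?thesis
    using ideal_multR[OF is_ideal_J7 J7_gens(1)] by (simp only: ideal_add[OF is_ideal_J7])
qed

subsection \<open>The Cremona bound\<close>

text \<open>A quadratic Cremona map with base points [010], [001], [211]. The factors of
  \<open>exc\<close> are the lines joining them, contracted to [011], [101], [110]
  respectively.\<close>

abbreviation (input) "psi1 \<equiv> X * (Y + Z - X)"
abbreviation (input) "psi2 \<equiv> Z * (2 * Y - X)"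
abbreviation (input) "psi3 \<equiv> Y * (2 * Z - X)"
abbreviation (input) "exc \<equiv> X * (2 * Y - X) * (2 * Z - X)"

lemma psi_diffs: "psi3 - psi2 = X * (Z - Y)" "psi3 - psi1 = (2 * Y - X) * (Z - X)"
  "psi2 - psi1 = (2 * Z - X) * (Y - X)"
  by (simp_all add: algebra_simps)

text \<open>The contracted lines contribute \<open>exc ^ n\<close>, of order at least
  \<open>3 * n\<close>. The map sends [100], [111], [110], [101] to [100], [111], [001], [010], so
  the cofactor vanishes to order \<open>n\<close> at \<open>four_points\<close>, lies in a power of
  \<open>K\<close> and has order at least \<open>2 * n\<close>.\<close>

lemma cremona_fat:
  assumes four: "f \<in> fat_ideal four_points n" and line: "f \<in> fat_ideal line_points n"
  shows "csub psi1 psi2 psi3 f \<in> fat_ideal {(0, 0, 0)} (5 * n)"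
proof -
  let ?f = "csub psi1 psi2 psi3 f"
  have f: "f \<in> ideal_pow (ideal_at X 0 0) n" "f \<in> ideal_pow (ideal_at X X 0) n"
    "f \<in> ideal_pow (ideal_at X 0 X) n" "f \<in> ideal_pow (ideal_at X X X) n"
    "f \<in> ideal_pow (ideal_at 0 Y 0) n" "f \<in> ideal_pow (ideal_at 0 0 Z) n"
    "f \<in> ideal_pow (ideal_at 0 Y Y) n"
    using four line by (simp_all add: fat_ideal_def four_points_def line_points_def)
  have d1: "X ^ n dvd ?f"
    by (rule power_dvd_csub[OF f(7)]) (simp_all only: csub_simps csub_gens psi_diffs, simp_all)
  have d2: "(2 * Y - X) ^ n dvd ?f"
    by (rule power_dvd_csub[OF f(3)]) (simp_all only: csub_simps csub_gens psi_diffs, simp_all)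
  have d3: "(2 * Z - X) ^ n dvd ?f"
    by (rule power_dvd_csub[OF f(2)]) (simp_all only: csub_simps csub_gens psi_diffs, simp_all)
  have ndvd: "\<not> 2 * Y - X dvd X" "\<not> 2 * Z - X dvd X * (2 * Y - X)"
    using not_dvd_if_csub[of "2 * Y" Y Z "2 * Y - X" X]
      not_dvd_if_csub[of "2 * Z" 0 Z "2 * Z - X" "X * (2 * Y - X)"] by simp_all
  have "exc ^ n dvd ?f"
    by (rule mult_power_dvd[OF prime_elem_linear_forms(7) ndvd(2)
          mult_power_dvd[OF prime_elem_linear_forms(6) ndvd(1) d1 d2] d3])
  then obtain g where g: "?f = exc ^ n * g" ..
  note iff = retraction_points[THEN retraction.in_ideal_iff]
  have "?f \<in> ideal_pow (ideal_at X 0 0) n"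
    by (rule ideal_at_image[OF f(1)]) (simp_all add: iff)
  moreover have "?f \<in> ideal_pow (ideal_at X X X) n"
    by (rule ideal_at_image[OF f(4)]) (simp_all add: iff)
  moreover have "?f \<in> ideal_pow (ideal_at X X 0) n"
    by (rule ideal_at_image[OF f(6)]) (simp_all add: iff)
  moreover have "?f \<in> ideal_pow (ideal_at X 0 X) n"
    by (rule ideal_at_image[OF f(5)]) (simp_all add: iff)
  ultimately have "exc ^ n * g \<in> fat_ideal four_points n"
    by (simp only: fat_ideal_def four_points_def g) blast
  then have "g \<in> fat_ideal four_points n"
    by (rule fat_ideal_cancel_unit[rotated]) (auto simp: four_points_def retraction_points)
  then have "g \<in> fat_ideal {(0, 0, 0)} (2 * n)"
    using fat_four_points_subset K_pow_subset_origin by blast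
  moreover have "exc ^ n \<in> fat_ideal {(0, 0, 0)} (3 * n)"
    by (intro fat_ideal_power_mult origin_mult3) (simp_all add: in_fat_ideal_1)
  ultimately have "exc ^ n * g \<in> fat_ideal {(0, 0, 0)} (3 * n + 2 * n)"
    by (intro fat_ideal_mult)
  then show ?thesis by (simp add: g)
qed

text \<open>At the origin the deformation is f(tX, tY, tZ) with parameter t, so its coefficients are
  the homogeneous components of \<open>f\<close>.\<close>

lemma deform_origin_coeff: "deform 0 0 0 (coeff (deform 0 0 0 f) i) = monom (coeff (deform 0 0 0 f) i) i"
proof (induction f arbitrary: i rule: cpoly3_induct)
  case (add f g)
  then show ?case by (simp add: add_monom)
next
  case (mult f g)
  have "deform 0 0 0 (coeff (deform 0 0 0 (f * g)) i) =
      (\<Sum>j\<le>i. monom (coeff (deform 0 0 0 f) j) j * monom (coeff (deform 0 0 0 g) (i - j)) (i - j))"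
    by (simp add: coeff_mult deform.sum mult.IH)
  also have "\<dots> = (\<Sum>j\<le>i. monom (coeff (deform 0 0 0 f) j * coeff (deform 0 0 0 g) (i - j)) i)"
    by (intro sum.cong) (simp_all add: mult_monom)
  also have "\<dots> = monom (coeff (deform 0 0 0 (f * g)) i) i"
    by (simp add: coeff_mult monom_sum)
  finally show ?case .
qed (auto simp: coeff_pCons monom_0 monom_Suc split: nat.split)

lemma poly_deform_origin: "poly (deform 0 0 0 f) c = csub (X * c) (Y * c) (Z * c) f"
  by (rule rhom_eqI[OF rhom_comp[OF rhom_poly deform.rhom_axioms] csub.rhom_axioms]) simp_all

text \<open>The quadratic map \<open>psi\<close> is birational: \<open>(B C, C Z, B Y)\<close> inverts it up to the factor \<open>c = A B C\<close>.\<close>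

lemma cremona_injective:
  assumes homogeneous: "deform 0 0 0 f = monom f i" and "csub psi1 psi2 psi3 f = 0"
  shows "f = 0"
proof -
  define A B C where "A = Y + Z - X" and "B = X + Z - Y" and "C = X + Y - Z"
  define c where "c = A * B * C"
  have "csub (B * C) (C * Z) (B * Y) psi1 = X * c" "csub (B * C) (C * Z) (B * Y) psi2 = Y * c"
    "csub (B * C) (C * Z) (B * Y) psi3 = Z * c"
    by (simp_all add: A_def B_def C_def c_def) (simp_all add: algebra_simps)
  then have "csub (X * c) (Y * c) (Z * c) f = csub (B * C) (C * Z) (B * Y) (csub psi1 psi2 psi3 f)"
    by (simp only: csub_csub)
  \<comment> \<open>By homogeneity, substituting \<open>X * c\<close>, \<open>Y * c\<close>,
    \<open>Z * c\<close> multiplies \<open>f\<close> by \<open>c ^ i\<close>.\<close>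
  then have "f * c ^ i = 0"
    using assms by (simp add: poly_monom flip: poly_deform_origin)
  moreover have "csub 1 1 1 c = 1"
    by (simp add: c_def A_def B_def C_def)
  then have "c \<noteq> 0"
    by (metis csub.zero zero_neq_one)
  ultimately show ?thesis by simp
qed

text \<open>The map is quadratic, so it doubles degrees: \<open>h\<close> applies it to the
  coefficients and squares the parameter.\<close>

lemma cremona_deform:
  "coeff (deform 0 0 0 (csub psi1 psi2 psi3 f)) (2 * i) = csub psi1 psi2 psi3 (coeff (deform 0 0 0 f) i)"
proof -
  let ?psi = "csub psi1 psi2 psi3"
  interpret c: rhom "\<lambda>k. [:?psi k:]"
    by unfold_locales (simp_all add: one_pCons)
  define h where "h = peval (\<lambda>k. [:?psi k:]) [:0, 0, 1:]"
  interpret h: rhom h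
    unfolding h_def by (rule c.rhom_peval)
  have h_pCons: "h (pCons a p) = pCons (?psi a) (pCons 0 (h p))" for a p
    by (simp add: h_def c.peval_pCons)
  have "deform 0 0 0 (?psi f) = h (deform 0 0 0 f)"
    by (rule rhom_eqI[OF rhom_comp[OF deform.rhom_axioms csub.rhom_axioms]
          rhom_comp[OF h.rhom_axioms deform.rhom_axioms]])
      (simp_all add: h_pCons h.zero smult_two)
  moreover have "coeff (h p) (2 * i) = ?psi (coeff p i)" for p
  proof (induction p arbitrary: i)
    case (pCons a p)
    then show ?case by (cases i) (simp_all add: h_pCons)
  qed (simp add: h.zero)
  ultimately show ?thesis by simp
qed

text \<open>The component of degree \<open>i\<close> pulls back to degree \<open>2 * i\<close>,
  which vanishes if \<open>2 * i < 5 * m\<close>; injectivity then kills the component. The bound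
  allows \<open>n\<close> up to 5m/2 rounded up.\<close>

lemma in_origin_if_in_fat:
  assumes "f \<in> fat_ideal four_points m" "f \<in> fat_ideal line_points m" and n: "2 * n \<le> 5 * m + 1"
  shows "f \<in> fat_ideal {(0, 0, 0)} n"
proof -
  have t: "[:0, 1:] ^ n = (monom 1 n :: cpoly3 poly)" for n
    by (simp add: monom_altdef)
  note iff = retraction_points(8)[THEN retraction.in_ideal_pow_iff, unfolded t monom_1_dvd_iff']
  have "coeff (deform 0 0 0 f) i = 0" if "i < n" for i
  proof (rule cremona_injective[OF deform_origin_coeff])
    have "csub psi1 psi2 psi3 f \<in> ideal_pow (ideal_at 0 0 0) (5 * m)"
      using cremona_fat[OF assms(1,2)] by (simp add: fat_ideal_def)
    moreover have "2 * i < 5 * m"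
      using n that by simp
    ultimately have "coeff (deform 0 0 0 (csub psi1 psi2 psi3 f)) (2 * i) = 0"
      unfolding iff by blast
    then show "csub psi1 psi2 psi3 (coeff (deform 0 0 0 f) i) = 0"
      by (simp only: cremona_deform)
  qed
  then show ?thesis
    by (simp add: fat_ideal_def iff)
qed

subsection \<open>Associated primes and symbolic powers\<close>

lemma in_J7_if_combination: "f = u * F + v * (Z * X * (Z - X)) + w * (X * Y * (X - Y)) \<Longrightarrow> f \<in> J7"
  using is_ideal_J7 by (simp only: ideal_add ideal_multL J7_gens)

lemma J7_pow_subset_fat:
  "ideal_pow J7 n \<subseteq> fat_ideal four_points n" "ideal_pow J7 n \<subseteq> fat_ideal line_points n"
  "ideal_pow J7 n \<subseteq> fat_ideal {(0, 0, 0)} (3 * n)"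
proof -
  have "ideal_pow J7 n \<subseteq> fat_ideal four_points (1 * n)" "ideal_pow J7 n \<subseteq> fat_ideal line_points (1 * n)"
    unfolding J7_def by (rule ideal_pow_subset_fat_ideal; auto simp: in_fat_ideal_1)+
  then show "ideal_pow J7 n \<subseteq> fat_ideal four_points n" "ideal_pow J7 n \<subseteq> fat_ideal line_points n"
    by simp_all
  have "F \<in> fat_ideal {(0, 0, 0)} 3" "Z * X * (Z - X) \<in> fat_ideal {(0, 0, 0)} 3"
    "X * Y * (X - Y) \<in> fat_ideal {(0, 0, 0)} 3"
    by (intro origin_mult3 origin_1)+
  then show "ideal_pow J7 n \<subseteq> fat_ideal {(0, 0, 0)} (3 * n)"
    unfolding J7_def by (intro ideal_pow_subset_fat_ideal) blast
qed

lemma J7_pow_subset_point: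
  assumes "(a, b, c) \<in> four_points \<union> line_points"
  shows "ideal_pow J7 n \<subseteq> ideal_pow (ideal_at a b c) n"
  using assms J7_pow_subset_fat[of n] by (auto simp: fat_ideal_def)

lemma retraction_at_point: "(a, b, c) \<in> four_points \<union> line_points \<Longrightarrow> retraction a b c"
  by (auto simp: four_points_def line_points_def retraction_points)

text \<open>If \<open>f * u\<close> is in \<open>J7\<close>, it vanishes at the point, where
  \<open>u\<close> does not; so the quotient of \<open>J7\<close> by \<open>u\<close> is the ideal
  of the point.\<close>

lemma ideal_at_in_Ass:
  assumes abc: "(a, b, c) \<in> four_points \<union> line_points" and u: "csub a b c u \<noteq> 0"
    and "(X - a) * u \<in> J7" "(Y - b) * u \<in> J7" "(Z - c) * u \<in> J7"
  shows "ideal_at a b c \<in> Ass J7"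
proof -
  interpret retraction a b c
    using abc by (rule retraction_at_point)
  have "prime_ideal (ideal_at a b c)"
  proof -
    have "1 \<notin> ideal_at a b c"
      by (simp add: in_ideal_iff)
    then have "ideal_at a b c \<noteq> UNIV"
      by blast
    then show ?thesis
      unfolding prime_ideal_def by (simp add: is_ideal_ideal_at in_ideal_iff)
  qed
  moreover have "ideal_at a b c = {f. f * u \<in> J7}"
  proof
    have "is_ideal {f. \<forall>v\<in>{u}. f * v \<in> J7}"
      by (rule is_ideal_quotient[OF is_ideal_J7])
    then show "ideal_at a b c \<subseteq> {f. f * u \<in> J7}"
      unfolding ideal_at_def using assms(3-5) by (intro gen_ideal_least) simp_all
    show "{f. f * u \<in> J7} \<subseteq> ideal_at a b c"
      using J7_pow_subset_point[OF abc, of "Suc 0"] u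
      by (auto simp: ideal_pow_1 is_ideal_J7 is_ideal_ideal_at in_ideal_iff)
  qed
  ultimately show ?thesis
    unfolding Ass_def by blast
qed

lemma points_in_Ass:
  assumes "(a, b, c) \<in> four_points \<union> line_points"
  shows "ideal_at a b c \<in> Ass J7"
proof -
  note I = ideal_at_in_Ass and J = in_J7_if_combination
  have zero: "(l - l) * u \<in> J7" for l u
    by (simp add: ideal_zero is_ideal_J7)
  \<comment> \<open>Each \<open>u\<close> is a product of three lines that cover the other six
    points and miss the given one.\<close>
  have "ideal_at X 0 0 \<in> Ass J7"
    by (rule I[where u = "X * (X - Y) * (X - Z)"])
      (simp_all only: zero, simp_all add: four_points_def,
        rule J[of _ 0 0 "X - Z"], simp add: algebra_simps,
        rule J[of _ 0 "- (X - Y)" 0], simp add: algebra_simps)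
  moreover have "ideal_at 0 Y 0 \<in> Ass J7"
    by (rule I[where u = "Y * (Y - X) * (Y - Z)"])
      (simp_all only: zero, simp_all add: line_points_def,
        rule J[of _ 0 0 "- (Y - Z)"], simp add: algebra_simps,
        rule J[of _ "Y - X" 0 0], simp add: algebra_simps)
  moreover have "ideal_at 0 0 Z \<in> Ass J7"
    by (rule I[where u = "Z * (Z - X) * (Z - Y)"])
      (simp_all only: zero, simp_all add: line_points_def,
        rule J[of _ 0 "Z - Y" 0], simp add: algebra_simps,
        rule J[of _ "- (Z - X)" 0 0], simp add: algebra_simps)
  moreover have "ideal_at X X 0 \<in> Ass J7"
    by (rule I[where u = "X * Y * (X - Z)"])
      (simp_all only: zero, simp_all add: four_points_def,
        rule J[of _ 0 0 "- (X - Z)"], simp add: algebra_simps,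
        rule J[of _ 0 "- Y" 0], simp add: algebra_simps)
  moreover have "ideal_at X 0 X \<in> Ass J7"
    by (rule I[where u = "X * Z * (X - Y)"])
      (simp_all only: zero, simp_all add: four_points_def,
        rule J[of _ 0 0 Z], simp add: algebra_simps,
        rule J[of _ 0 "X - Y" 0], simp add: algebra_simps)
  moreover have "ideal_at 0 Y Y \<in> Ass J7"
    by (rule I[where u = "Y * Z * (Y - X)"])
      (simp_all only: zero, simp_all add: line_points_def,
        rule J[of _ 0 0 "- Z"], simp add: algebra_simps,
        rule J[of _ "- (Y - X)" 0 0], simp add: algebra_simps)
  moreover have "ideal_at X X X \<in> Ass J7"
    by (rule I[where u = "X * Y * Z"])
      (simp_all only: zero, simp_all add: four_points_def,
        rule J[of _ 0 0 "- Z"], simp add: algebra_simps,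
        rule J[of _ 0 Y 0], simp add: algebra_simps)
  ultimately show ?thesis
    using assms by (auto simp: four_points_def line_points_def)
qed

text \<open>A denominator outside the ideal of a point can be cancelled, because powers of that
  ideal are primary.\<close>

lemma symbolic_power_subset_fat:
  assumes f: "f \<in> symbolic_power J7 m"
  shows "f \<in> fat_ideal four_points m" "f \<in> fat_ideal line_points m"
proof -
  have "f \<in> ideal_pow (ideal_at a b c) m" if abc: "(a, b, c) \<in> four_points \<union> line_points" for a b c
  proof -
    obtain s where "s \<notin> ideal_at a b c" "s * f \<in> ideal_pow J7 m"
      using f points_in_Ass[OF abc] unfolding symbolic_power_def by blast
    then show ?thesis
      using retraction.cancel_unit[OF retraction_at_point[OF abc]] J7_pow_subset_point[OF abc] by blast
  qed
  then show "f \<in> fat_ideal four_points m" "f \<in> fat_ideal line_points m"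
    by (auto simp: fat_ideal_def)
qed

lemma symbolic_power_subset_J7_pow:
  assumes "6 * r < 5 * m"
  shows "symbolic_power J7 m \<subseteq> ideal_pow J7 r"
proof
  fix f assume "f \<in> symbolic_power J7 m"
  note fat = symbolic_power_subset_fat[OF this]
  \<comment> \<open>The strict inequality gives
    \<open>2 * (3 * r + 1) \<le> 5 * m + 1\<close>.\<close>
  have "f \<in> fat_ideal {(0, 0, 0)} (3 * r + 1)"
    by (rule in_origin_if_in_fat[OF fat]) (use assms in simp)
  moreover have "r \<le> m"
    using assms by simp
  ultimately show "f \<in> ideal_pow J7 r"
    using fat fat_ideal_anti by (intro in_J7_pow) blast+
qed

section \<open>Localised powers and the lower bound\<close>

definition local_pow :: "'a::comm_ring_1 set \<Rightarrow> 'a set \<Rightarrow> nat \<Rightarrow> 'a set" where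
  "local_pow P I n = {f. \<exists>s. s \<notin> P \<and> s * f \<in> ideal_pow I n}"

lemma local_powI: "s \<notin> P \<Longrightarrow> s * f \<in> ideal_pow I n \<Longrightarrow> f \<in> local_pow P I n"
  unfolding local_pow_def by blast

lemma local_pow_mult:
  assumes P: "prime_ideal P" and I: "is_ideal I"
    and "f \<in> local_pow P I m" "g \<in> local_pow P I n"
  shows "f * g \<in> local_pow P I (m + n)"
proof -
  obtain s t where st: "s \<notin> P" "s * f \<in> ideal_pow I m" "t \<notin> P" "t * g \<in> ideal_pow I n"
    using assms(3,4) unfolding local_pow_def by blast
  show ?thesis
  proof (rule local_powI)
    show "s * t \<notin> P"
      using P st unfolding prime_ideal_def by blast
    show "s * t * (f * g) \<in> ideal_pow I (m + n)"
      using ideal_pow_mult[OF I st(2,4)] by (simp add: mult_ac)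
  qed
qed

lemma is_ideal_local_pow:
  assumes P: "prime_ideal P"
  shows "is_ideal (local_pow P I n)"
  unfolding is_ideal_def
proof (intro conjI ballI allI)
  have "1 \<notin> P"
    using P ideal_multR[of P 1] unfolding prime_ideal_def by auto
  then show "0 \<in> local_pow P I n"
    by (rule local_powI) (simp add: ideal_pow_zero)
  show "r * f \<in> local_pow P I n" if f: "f \<in> local_pow P I n" for f r
  proof -
    obtain s where s: "s \<notin> P" "s * f \<in> ideal_pow I n"
      using f unfolding local_pow_def by blast
    then show ?thesis
      using ideal_pow_multL[OF s(2), of r] by (intro local_powI[OF s(1)]) (simp add: mult.left_commute)
  qed
  show "f + g \<in> local_pow P I n" if fg: "f \<in> local_pow P I n" "g \<in> local_pow P I n" for f g
  proof -
    obtain s t where st: "s \<notin> P" "s * f \<in> ideal_pow I n" "t \<notin> P" "t * g \<in> ideal_pow I n"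
      using fg unfolding local_pow_def by blast
    show ?thesis
    proof (rule local_powI)
      show "s * t \<notin> P"
        using P st unfolding prime_ideal_def by blast
      have "s * t * (f + g) = t * (s * f) + s * (t * g)"
        by (simp add: algebra_simps)
      then show "s * t * (f + g) \<in> ideal_pow I n"
        using st by (simp add: ideal_pow_add ideal_pow_multL)
    qed
  qed
qed

text \<open>The six lines through three of the points, doubled, and the three lines through two of the
  double points of that arrangement: degree 15, multiplicity 6 at each of the seven points.\<close>

definition lines15 :: cpoly3 where
  "lines15 = (X * Y * Z * (X - Y) * (Y - Z) * (Z - X))\<^sup>2 * ((Y + Z - X) * (X + Z - Y) * (X + Y - Z))"

text \<open>Suppose all variables multiply \<open>a\<close> into \<open>J7\<close>. At each of the
  seven points some variable is non-zero, so \<open>a\<close> vanishes there and lies in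
  \<open>J7\<close>, which makes \<open>P\<close> the unit ideal.\<close>

lemma Ass_not_maximal:
  assumes "P \<in> Ass J7"
  shows "X \<notin> P \<or> Y \<notin> P \<or> Z \<notin> P"
proof (rule ccontr)
  assume *: "\<not> ?thesis"
  obtain a where a: "P = {r. r * a \<in> J7}" and P: "prime_ideal P"
    using assms unfolding Ass_def by blast
  have J7: "J7 \<subseteq> fat_ideal four_points (Suc 0)" "J7 \<subseteq> fat_ideal line_points (Suc 0)"
    using J7_pow_subset_fat[of "Suc 0"] by (simp_all add: ideal_pow_1 is_ideal_J7)
  have "X * a \<in> J7" "Y * a \<in> J7" "Z * a \<in> J7"
    using * a by auto
  then have "X * a \<in> fat_ideal four_points (Suc 0)" "Y * a \<in> fat_ideal line_points (Suc 0)"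
    "Z * a \<in> fat_ideal line_points (Suc 0)"
    using J7 by blast+
  then have "a \<in> fat_ideal four_points (Suc 0)" "a \<in> fat_ideal line_points (Suc 0)"
    by (simp_all add: in_fat_ideal_1)
  then have "P = UNIV"
    unfolding a using in_J7 ideal_multL[OF is_ideal_J7] by auto
  then show False
    using P by (simp add: prime_ideal_def)
qed

text \<open>An associated prime contains a linear factor of every generator of \<open>J7\<close>,
  which singles out one of the seven points. Lines through that point lie in the localised
  \<open>J7\<close>, and six factors of \<open>lines15\<close> are such lines.\<close>

lemma lines15_in_local_pow:
  assumes "P \<in> Ass J7"
  shows "lines15 \<in> local_pow P J7 6"
proof -
  have P: "prime_ideal P"
    using assms by (simp add: Ass_def)
  then have idP: "is_ideal P"
    by (simp add: prime_ideal_def)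
  obtain a where a: "P = {r. r * a \<in> J7}"
    using assms by (auto simp: Ass_def)
  have J7_P: "g \<in> P" if "g \<in> J7" for g
    unfolding a using ideal_multR[OF is_ideal_J7 that] by simp
  have primeP: "g \<in> P \<or> h \<in> P" if "g * h \<in> P" for g h
    using P that by (simp add: prime_ideal_def)
  have notinP: "g * h \<notin> P" if "g \<notin> P" "h \<notin> P" for g h
    using primeP that by blast
  have swap: "l - l' \<notin> P" if "l' - l \<notin> P" for l l'
    using ideal_uminus[OF idP, of "l - l'"] that by auto
  have notin_diff: "l - l' \<notin> P" if "l \<in> P" "l' \<notin> P" for l l'
    using ideal_diff[OF idP that(1), of "l - l'"] that by auto
  have notin_diff': "l' - l \<notin> P" if "l \<in> P" "l' \<notin> P" for l l'
    using swap[OF notin_diff[OF that]] .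
  have in_trans: "l \<in> P" if "l' \<in> P" "l - l' \<in> P" for l l'
    using ideal_add[OF idP that] by simp
  have in_trans': "l \<in> P" if "l' \<in> P" "l' - l \<in> P" for l l'
    using ideal_diff[OF idP that] by simp
  let ?L = "local_pow P J7 (Suc 0)"
  \<comment> \<open>Up to sign a generator is \<open>s * t * l\<close>, where \<open>s\<close> and
    \<open>t\<close> become invertible.\<close>
  have L: "l \<in> ?L" if "s \<notin> P" "t \<notin> P" "s * t * l = g \<or> s * t * l = - g"
    "g \<in> {F, Z * X * (Z - X), X * Y * (X - Y)}" for s t l g
  proof (rule local_powI)
    show "s * t \<notin> P"
      using that(1,2) by (rule notinP)
    have "g \<in> J7"
      using that(4) J7_gens by blast
    then show "s * t * l \<in> ideal_pow J7 (Suc 0)"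
      using that(3) ideal_uminus[OF is_ideal_J7] by (auto simp: ideal_pow_1 is_ideal_J7)
  qed
  note L_add = ideal_add[OF is_ideal_local_pow[OF P, of J7]]
    and L_diff = ideal_diff[OF is_ideal_local_pow[OF P, of J7]]
  have six: "(u * v)\<^sup>2 * (p * q) * w \<in> local_pow P J7 6"
    if "u \<in> ?L" "v \<in> ?L" "p \<in> ?L" "q \<in> ?L" for u v p q w
  proof -
    note mult = local_pow_mult[OF P is_ideal_J7]
    have "u * v * (u * v) * (p * q) \<in> local_pow P J7 (Suc 0 + Suc 0 + (Suc 0 + Suc 0) + (Suc 0 + Suc 0))"
      by (intro mult that)
    then show ?thesis
      using ideal_multR[OF is_ideal_local_pow[OF P]] by (simp add: power2_eq_square eval_nat_numeral)
  qed
  \<comment> \<open>The case names are the coordinates of the points.\<close>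
  consider (001) "X \<in> P" "Y \<in> P" "Z \<notin> P" | (010) "X \<in> P" "Z \<in> P" "Y \<notin> P"
    | (011) "X \<in> P" "Y - Z \<in> P" "Y \<notin> P" "Z \<notin> P"
    | (100) "Y \<in> P" "Z \<in> P" "X \<notin> P"
    | (101) "Y \<in> P" "Z - X \<in> P" "X \<notin> P" "Z \<notin> P"
    | (110) "Z \<in> P" "X - Y \<in> P" "X \<notin> P" "Y \<notin> P"
    | (111) "X - Y \<in> P" "Z - X \<in> P" "X \<notin> P" "Y \<notin> P" "Z \<notin> P"
  proof -
    have "Y \<in> P \<or> Z \<in> P \<or> Y - Z \<in> P" "Z \<in> P \<or> X \<in> P \<or> Z - X \<in> P" "X \<in> P \<or> Y \<in> P \<or> X - Y \<in> P"
      using J7_gens[THEN J7_P] primeP by blast+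
    then show ?thesis
      using Ass_not_maximal[OF assms] that in_trans in_trans' by metis
  qed
  then show ?thesis
  proof cases
    case 001
    have "X \<in> ?L"
      by (rule L[of Z "Z - X" _ "Z * X * (Z - X)"]) (use 001 notin_diff' in \<open>simp_all add: mult_ac\<close>)
    moreover have "Y \<in> ?L"
      by (rule L[of Z "Y - Z" _ F]) (use 001 notin_diff in \<open>simp_all add: mult_ac\<close>)
    \<comment> \<open>Three doubled lines pass through [001].\<close>
    ultimately have "(X * Y)\<^sup>2 * ((X - Y) * (X - Y)) *
        ((Z * (Y - Z) * (Z - X))\<^sup>2 * ((Y + Z - X) * (X + Z - Y) * (X + Y - Z))) \<in> local_pow P J7 6"
      by (intro six L_diff)
    then show ?thesis
      by (simp add: lines15_def power2_eq_square mult_ac)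
  next
    case 010
    have "X \<in> ?L"
      by (rule L[of Y "X - Y" _ "X * Y * (X - Y)"]) (use 010 notin_diff in \<open>simp_all add: mult_ac\<close>)
    moreover have "Z \<in> ?L"
      by (rule L[of Y "Y - Z" _ F]) (use 010 notin_diff' in \<open>simp_all add: mult_ac\<close>)
    ultimately have "(X * Z)\<^sup>2 * ((Z - X) * (Z - X)) *
        ((Y * (X - Y) * (Y - Z))\<^sup>2 * ((Y + Z - X) * (X + Z - Y) * (X + Y - Z))) \<in> local_pow P J7 6"
      by (intro six L_diff)
    then show ?thesis
      by (simp add: lines15_def power2_eq_square mult_ac)
  next
    case 100
    have "Y \<in> ?L"
      by (rule L[of X "X - Y" _ "X * Y * (X - Y)"]) (use 100 notin_diff' in \<open>simp_all add: mult_ac\<close>)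
    moreover have "Z \<in> ?L"
      by (rule L[of X "Z - X" _ "Z * X * (Z - X)"]) (use 100 notin_diff in \<open>simp_all add: mult_ac\<close>)
    ultimately have "(Y * Z)\<^sup>2 * ((Y - Z) * (Y - Z)) *
        ((X * (X - Y) * (Z - X))\<^sup>2 * ((Y + Z - X) * (X + Z - Y) * (X + Y - Z))) \<in> local_pow P J7 6"
      by (intro six L_diff)
    then show ?thesis
      by (simp add: lines15_def power2_eq_square mult_ac)
  next
    case 011
    have "X \<in> ?L"
      by (rule L[of Y "X - Y" _ "X * Y * (X - Y)"]) (use 011 notin_diff in \<open>simp_all add: mult_ac\<close>)
    moreover have "Y - Z \<in> ?L"
      by (rule L[of Y Z _ F]) (use 011 in simp_all)
    \<comment> \<open>Only two doubled lines pass through [011]; the simple lines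
      \<open>X + Z - Y\<close> and \<open>X + Y - Z\<close> supply the other two factors.\<close>
    ultimately have "(X * (Y - Z))\<^sup>2 * ((X - (Y - Z)) * (X + (Y - Z))) *
        ((Y * Z * (X - Y) * (Z - X))\<^sup>2 * (Y + Z - X)) \<in> local_pow P J7 6"
      by (intro six) (blast intro: L_diff L_add)+
    then show ?thesis
      by (simp add: lines15_def power2_eq_square mult_ac diff_diff_eq2 add_diff_eq)
  next
    case 101
    have "Y \<in> ?L"
      by (rule L[of X "X - Y" _ "X * Y * (X - Y)"]) (use 101 notin_diff' in \<open>simp_all add: mult_ac\<close>)
    moreover have "Z - X \<in> ?L"
      by (rule L[of Z X _ "Z * X * (Z - X)"]) (use 101 in simp_all)
    ultimately have "(Y * (Z - X))\<^sup>2 * ((Y + (Z - X)) * (Y - (Z - X))) *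
        ((X * Z * (X - Y) * (Y - Z))\<^sup>2 * (X + Z - Y)) \<in> local_pow P J7 6"
      by (intro six) (blast intro: L_diff L_add)+
    then show ?thesis
      by (simp add: lines15_def power2_eq_square mult_ac diff_diff_eq2 add_diff_eq add.commute)
  next
    case 110
    have "Z \<in> ?L"
      by (rule L[of X "Z - X" _ "Z * X * (Z - X)"]) (use 110 notin_diff in \<open>simp_all add: mult_ac\<close>)
    moreover have "X - Y \<in> ?L"
      by (rule L[of X Y _ "X * Y * (X - Y)"]) (use 110 in simp_all)
    ultimately have "(Z * (X - Y))\<^sup>2 * ((Z - (X - Y)) * (Z + (X - Y))) *
        ((X * Y * (Z - X) * (Y - Z))\<^sup>2 * (X + Y - Z)) \<in> local_pow P J7 6"
      by (intro six) (blast intro: L_diff L_add)+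
    then show ?thesis
      by (simp add: lines15_def power2_eq_square mult_ac diff_diff_eq2 add_diff_eq add.commute)
  next
    case 111
    have "X - Y \<in> ?L"
      by (rule L[of X Y _ "X * Y * (X - Y)"]) (use 111 in simp_all)
    moreover have "Z - X \<in> ?L"
      by (rule L[of Z X _ "Z * X * (Z - X)"]) (use 111 in simp_all)
    moreover have "Y - Z \<in> ?L"
      by (rule L[of Y Z _ F]) (use 111 in simp_all)
    ultimately have "((X - Y) * (Z - X))\<^sup>2 * ((Y - Z) * (Y - Z)) *
        ((X * Y * Z)\<^sup>2 * ((Y + Z - X) * (X + Z - Y) * (X + Y - Z))) \<in> local_pow P J7 6"
      by (intro six)
    then show ?thesis
      by (simp add: lines15_def power2_eq_square mult_ac)
  qed
qed

lemma lines15_power_in_symbolic_power: "lines15 ^ n \<in> symbolic_power J7 (6 * n)"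
proof -
  have "lines15 ^ n \<in> local_pow P J7 (6 * n)" if P: "P \<in> Ass J7" for P
  proof (induction n)
    case 0
    have "1 \<notin> P"
      using P ideal_multR[of P 1] by (auto simp: Ass_def prime_ideal_def)
    then show ?case
      by (intro local_powI[of 1]) simp_all
  next
    case (Suc n)
    have "prime_ideal P"
      using P by (simp add: Ass_def)
    from local_pow_mult[OF this is_ideal_J7 lines15_in_local_pow[OF P] Suc] show ?case
      by simp
  qed
  then show ?thesis
    by (auto simp: symbolic_power_def local_pow_def)
qed

text \<open>\<open>lines15 ^ n\<close> is a non-zero form of degree \<open>15 * n\<close>, while the
  \<open>r\<close>-th power of \<open>J7\<close> has no terms of degree below
  \<open>3 * r\<close>.\<close>

lemma lines15_power_notin_J7_pow:
  assumes "5 * n < r"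
  shows "lines15 ^ n \<notin> ideal_pow J7 r"
proof
  assume "lines15 ^ n \<in> ideal_pow J7 r"
  then have "lines15 ^ n \<in> ideal_pow (ideal_at 0 0 0) (3 * r)"
    using J7_pow_subset_fat(3) by (auto simp: fat_ideal_def)
  then have "monom 1 (3 * r) dvd deform 0 0 0 (lines15 ^ n)"
    using retraction_points(8)[THEN retraction.in_ideal_pow_iff] by (simp add: monom_altdef)
  moreover have linear: "deform 0 0 0 l = monom l 1"
    if "l \<in> {X, Y, Z, X - Y, Y - Z, Z - X, Y + Z - X, X + Z - Y, X + Y - Z}" for l
    using that by (auto simp: monom_Suc monom_0)
  have "deform 0 0 0 lines15 = monom lines15 15"
    unfolding lines15_def deform.mult deform.power
    by (simp add: linear mult_monom monom_power del: deform_simps deform_gens)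
  then have "deform 0 0 0 (lines15 ^ n) = monom (lines15 ^ n) (15 * n)"
    by (simp add: monom_power)
  ultimately have "lines15 ^ n = 0"
    using assms by (auto simp: monom_1_dvd_iff' dest: spec[of _ "15 * n"])
  \<comment> \<open>The point (1, 2, 4) lies on none of the nine lines.\<close>
  moreover have "csub 1 2 4 lines15 \<noteq> 0"
    by (simp add: lines15_def)
  then have "lines15 \<noteq> 0"
    by (metis csub.zero)
  ultimately show False by simp
qed

section \<open>Both resurgences\<close>

lemma resurgence_J7:
  shows "resurgence J7 = ereal (6 / 5)" and "asymptotic_resurgence J7 = ereal (6 / 5)"
proof -
  have upper: "5 * m \<le> 6 * r" if "\<not> symbolic_power J7 m \<subseteq> ideal_pow J7 r" for m r
    using that symbolic_power_subset_J7_pow[of r m] by linarith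
  \<comment> \<open>\<open>lines15 ^ (k * t)\<close> is the witness: the 1 in
    \<open>5 * k + 1\<close> makes its degree too small for every positive \<open>t\<close>, and the
    ratios 6k/(5k+1) tend to 6/5.\<close>
  have lower: "\<not> symbolic_power J7 (6 * k * t) \<subseteq> ideal_pow J7 ((5 * k + 1) * t)" if "t \<ge> 1" for k t
    using lines15_power_in_symbolic_power[of "k * t"] lines15_power_notin_J7_pow[of "k * t" "(5 * k + 1) * t"] that
    by (auto simp: mult.assoc)
  have ratio: "ereal (real m / real r) \<le> ereal (6 / 5)" if "5 * m \<le> 6 * r" "r \<ge> 1" for m r :: nat
  proof -
    have "5 * real m \<le> 6 * real r"
      using that(1) by (metis of_nat_le_iff of_nat_mult of_nat_numeral)
    then show ?thesis
      using that(2) by (simp add: divide_simps)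
  qed
  have limit: "ereal (6 / 5) \<le> s" if "\<And>k. k \<ge> 1 \<Longrightarrow> ereal (real (6 * k) / real (5 * k + 1)) \<le> s" for s
  proof (rule LIMSEQ_le_const2)
    have "(\<lambda>k. real (6 * k) / real (5 * k + 1)) \<longlonglongrightarrow> 6 / 5"
      by real_asymp
    then show "(\<lambda>k. ereal (real (6 * k) / real (5 * k + 1))) \<longlonglongrightarrow> ereal (6 / 5)"
      by simp
  qed (use that in blast)
  show "resurgence J7 = ereal (6 / 5)"
    unfolding resurgence_def
  proof (rule antisym)
    show "Sup {ereal (real m / real r) |m r. m \<ge> 1 \<and> r \<ge> 1 \<and>
        \<not> symbolic_power J7 m \<subseteq> ideal_pow J7 r} \<le> ereal (6 / 5)"
      by (rule Sup_least) (use ratio upper in blast)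
    show "ereal (6 / 5) \<le> Sup {ereal (real m / real r) |m r. m \<ge> 1 \<and> r \<ge> 1 \<and>
        \<not> symbolic_power J7 m \<subseteq> ideal_pow J7 r}"
    proof (rule limit, rule Sup_upper, intro CollectI exI conjI)
      fix k :: nat assume "k \<ge> 1"
      then show "6 * k \<ge> 1" "5 * k + 1 \<ge> 1" by simp_all
      show "\<not> symbolic_power J7 (6 * k) \<subseteq> ideal_pow J7 (5 * k + 1)"
        using lower[of 1 k] by simp
    qed simp
  qed
  show "asymptotic_resurgence J7 = ereal (6 / 5)"
    unfolding asymptotic_resurgence_def
  proof (rule antisym)
    \<comment> \<open>One positive \<open>t\<close> with non-containment suffices, since it cancels
      from the inequality.\<close>
    have "ereal (real m / real r) \<le> ereal (6 / 5)"
      if r: "r \<ge> 1" and ev: "\<forall>\<^sub>F t in sequentially. \<not> symbolic_power J7 (m * t) \<subseteq> ideal_pow J7 (r * t)" for m r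
    proof -
      obtain t where t: "t \<ge> 1" "\<not> symbolic_power J7 (m * t) \<subseteq> ideal_pow J7 (r * t)"
        using eventually_happens[OF eventually_conj[OF eventually_ge_at_top[of 1] ev]] by auto
      have "(5 * m) * t \<le> (6 * r) * t"
        using upper[OF t(2)] by (simp add: mult.assoc)
      then have "5 * m \<le> 6 * r"
        using t(1) by simp
      then show ?thesis using r by (rule ratio)
    qed
    then show "Sup {ereal (real m / real r) |m r. m \<ge> 1 \<and> r \<ge> 1 \<and>
        (\<forall>\<^sub>F t in sequentially. \<not> symbolic_power J7 (m * t) \<subseteq> ideal_pow J7 (r * t))} \<le> ereal (6 / 5)"
      by (intro Sup_least) blast
    show "ereal (6 / 5) \<le> Sup {ereal (real m / real r) |m r. m \<ge> 1 \<and> r \<ge> 1 \<and>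
        (\<forall>\<^sub>F t in sequentially. \<not> symbolic_power J7 (m * t) \<subseteq> ideal_pow J7 (r * t))}"
    proof (rule limit, rule Sup_upper, intro CollectI exI conjI)
      fix k :: nat assume "k \<ge> 1"
      then show "6 * k \<ge> 1" "5 * k + 1 \<ge> 1" by simp_all
      show "\<forall>\<^sub>F t in sequentially. \<not> symbolic_power J7 (6 * k * t) \<subseteq> ideal_pow J7 ((5 * k + 1) * t)"
        using eventually_ge_at_top[of 1] by eventually_elim (rule lower)
    qed simp
  qed
qed

theorem theorem4p3:
  defines "J \<equiv> gen_ideal {varY * varZ * (varY - varZ), varZ * varX * (varZ - varX),
                           varX * varY * (varX - varY)}"
  shows "resurgence J = ereal (6 / 5) \<and> asymptotic_resurgence J = ereal (6 / 5)"
  using resurgence_J7 unfolding J_def J7_def by blast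

end
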